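(* Let $G$ be a finite abelian group, let $\mathbf{k}$ be a field with $\operatorname{char}\mathbf{k}\nmid|G|$ containing the $|G|$th roots of unity, and let $V$ be a finite-dimensional representation of $G$ over $\mathbf{k}$, with $N=\dim V$ and a basis $x_1,\dots,x_N$ of $V^*$ on which $G$ acts diagonally. Then $$\beta^{\mathbf{r}}_{\mathrm{field}}(G,V)=\min\{d:L(G,V)=\langle L(G,V)\cap d\Omega_N\rangle\}$$ and $$\gamma^{\mathbf{r}}_{\mathrm{field}}(G,V)=\min\{d:\operatorname{rk}\langle L(G,V)\cap d\Omega_N\rangle=N\}.$$
   Context: $\mathbf{k}[V]=\mathbf{k}[x_1,\dots,x_N]$ is the polynomial ring of $V$ (the symmetric algebra of $V^*$, with its induced $G$-action), $\mathbf{k}(V)$ is its fraction field, and $\mathbf{k}(V)^G$ is the field of invariant rational functions. For $f\in\mathbf{k}(V)$ written as $f=f_1/f_2$ with $f_1,f_2\in\mathbf{k}[V]$ and $\gcd(f_1,f_2)=1$, the degree of $f$ is $\deg f:=\deg f_1+\deg f_2$ (constants, including $0$, have degree $0$). $\mathbf{k}(V)^G_{\leq d}$ is the set of invariant rational functions of degree $\leq d$. Define $$\beta^{\mathbf{r}}_{\mathrm{field}}(G,V):=\min\{d:\mathbf{k}(V)^G\text{ is generated as a field (over }\mathbf{k})\text{ by }\mathbf{k}(V)^G_{\leq d}\},$$ $$\gamma^{\mathbf{r}}_{\mathrm{field}}(G,V):=\min\{d:\mathbf{k}(V)^G_{\leq d}\text{ contains a transcendence basis for }\mathbf{k}(V)^G\text{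 over }\mathbf{k}\}.$$ All minima, here and in the claim, are over positive integers $d$. For $\mathbf{a}\in\mathbb{Z}^N$, $\mathbf{x}^{\mathbf{a}}$ is the Laurent monomial in $x_1,\dots,x_N$ with exponent vector $\mathbf{a}$, and $$L(G,V):=\{\mathbf{a}\in\mathbb{Z}^N: g\mathbf{x}^{\mathbf{a}}=\mathbf{x}^{\mathbf{a}}\text{ for all }g\in G\},$$ a subgroup of $\mathbb{Z}^N$. $\Omega_N\subset\mathbb{R}^N$ is the standard cross-polytope, the convex hull of the standard basis vectors and their negatives, equivalently the closed unit ball of the $L^1$ norm. $\langle A\rangle$ denotes the subgroup generated by $A$. *)

theory Defs
  imports
    "HOL-Library.Poly_Mapping"
    "HOL-Computational_Algebra.Computational_Algebra"
    "HOL-Algebra.Group"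
begin

section \<open>Polynomials and rational functions in \<open>x\<^sub>0, \<dots>, x\<^sub>N\<^sub>-\<^sub>1\<close>\<close>

text \<open>
  The number \<open>N\<close> of variables is a natural number (possibly \<open>0\<close>). All polynomials live in the
  integral domain of polynomials in countably many variables; \<open>k[x\<^sub>0, \<dots>, x\<^sub>N\<^sub>-\<^sub>1]\<close> and its fraction
  field are the subsets \<open>polys N\<close> and \<open>ratfuns N\<close> below.
\<close>

type_synonym 'k mpol = "(nat \<Rightarrow>\<^sub>0 nat) \<Rightarrow>\<^sub>0 'k"
type_synonym 'k ratf = "'k mpol fract"

definition mconst :: "'k \<Rightarrow> 'k::field mpol" where
  "mconst c = Poly_Mapping.single 0 c"

definition mvar :: "nat \<Rightarrow> 'k::field mpol" where
  "mvar i = Poly_Mapping.single (Poly_Mapping.single i 1) 1"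

definition polys :: "nat \<Rightarrow> 'k::field mpol set" where
  "polys N = {p. \<forall>m \<in> Poly_Mapping.keys p. Poly_Mapping.keys m \<subseteq> {..<N}}"

definition total_degree :: "'k::field mpol \<Rightarrow> nat" where
  "total_degree p =
     Max (insert 0 ((\<lambda>m. \<Sum>i\<in>Poly_Mapping.keys m. Poly_Mapping.lookup m i) ` Poly_Mapping.keys p))"

text \<open>
  The class of the library constant \<open>coprime\<close> requires a division operation, which
  \<open>mpol\<close> does not have; this is the same notion, relative to \<open>polys N\<close>.
\<close>

definition coprime_polys :: "nat \<Rightarrow> 'k::field mpol \<Rightarrow> 'k mpol \<Rightarrow> bool" where
  "coprime_polys N p q \<longleftrightarrow>
     (\<forall>r \<in> polys N. (\<exists>s \<in> polys N. p = r * s) \<and> (\<exists>s \<in> polys N. q = r * s) \<longrightarrow>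
        (\<exists>s \<in> polys N. r * s = 1))"

definition ratfuns :: "nat \<Rightarrow> 'k::field ratf set" where
  "ratfuns N = {Fract p q | p q. p \<in> polys N \<and> q \<in> polys N \<and> q \<noteq> 0}"

definition rconst :: "'k \<Rightarrow> 'k::field ratf" where
  "rconst c = Fract (mconst c) 1"

text \<open>
  A reduced fraction is determined by \<open>f\<close> up to a common nonzero constant, so the number
  selected here does not depend on the choice.
\<close>

definition ratfun_degree :: "nat \<Rightarrow> 'k::field ratf \<Rightarrow> nat" where
  "ratfun_degree N f =
     (SOME d. \<exists>p \<in> polys N. \<exists>q \<in> polys N. q \<noteq> 0 \<and> f = Fract p q \<and> coprime_polys N p q \<and>
        d = total_degree p + total_degree q)"


section \<open>Representations and the induced action on rational functions\<close>

definition linear_rep ::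
  "('g, 'b) monoid_scheme \<Rightarrow> ('k::field \<Rightarrow> 'v::ab_group_add \<Rightarrow> 'v) \<Rightarrow> ('g \<Rightarrow> 'v \<Rightarrow> 'v) \<Rightarrow> bool" where
  "linear_rep G scale \<rho> \<longleftrightarrow>
     (\<forall>g \<in> carrier G. Vector_Spaces.linear scale scale (\<rho> g)) \<and>
     \<rho> \<one>\<^bsub>G\<^esub> = id \<and>
     (\<forall>g \<in> carrier G. \<forall>h \<in> carrier G. \<rho> (g \<otimes>\<^bsub>G\<^esub> h) = \<rho> g \<circ> \<rho> h)"

definition dual_space :: "('k::field \<Rightarrow> 'v::ab_group_add \<Rightarrow> 'v) \<Rightarrow> ('v \<Rightarrow> 'k) set" where
  "dual_space scale = {\<phi>. Vector_Spaces.linear scale (*) \<phi>}"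

definition is_coords :: "nat \<Rightarrow> (nat \<Rightarrow> 'v \<Rightarrow> 'k::field) \<Rightarrow> ('v \<Rightarrow> 'k) \<Rightarrow> (nat \<Rightarrow> 'k) \<Rightarrow> bool" where
  "is_coords N x \<phi> c \<longleftrightarrow> (\<forall>j\<ge>N. c j = 0) \<and> \<phi> = (\<lambda>v. \<Sum>j<N. c j * x j v)"

definition dual_basis ::
  "('k::field \<Rightarrow> 'v::ab_group_add \<Rightarrow> 'v) \<Rightarrow> nat \<Rightarrow> (nat \<Rightarrow> 'v \<Rightarrow> 'k) \<Rightarrow> bool" where
  "dual_basis scale N x \<longleftrightarrow>
     (\<forall>i<N. x i \<in> dual_space scale) \<and> (\<forall>\<phi> \<in> dual_space scale. \<exists>!c. is_coords N x \<phi> c)"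

definition coords :: "nat \<Rightarrow> (nat \<Rightarrow> 'v \<Rightarrow> 'k::field) \<Rightarrow> ('v \<Rightarrow> 'k) \<Rightarrow> nat \<Rightarrow> 'k" where
  "coords N x \<phi> = (THE c. is_coords N x \<phi> c)"

definition dual_act ::
  "('g, 'b) monoid_scheme \<Rightarrow> ('g \<Rightarrow> 'v \<Rightarrow> 'v) \<Rightarrow> 'g \<Rightarrow> ('v \<Rightarrow> 'k) \<Rightarrow> 'v \<Rightarrow> 'k" where
  "dual_act G \<rho> g \<phi> = (\<lambda>v. \<phi> (\<rho> (inv\<^bsub>G\<^esub> g) v))"

text \<open>
  A basis \<open>x\<close> of the dual space identifies its symmetric algebra with \<open>polys N\<close>, the basis vector
  \<open>x i\<close> corresponding to \<open>mvar i\<close>. The induced action of \<open>g\<close> is the algebra endomorphism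
  substituting for \<open>mvar i\<close> the linear form that corresponds to \<open>g \<cdot> x i\<close>; no diagonality is
  assumed in these definitions.
\<close>

definition linear_form :: "nat \<Rightarrow> (nat \<Rightarrow> 'v \<Rightarrow> 'k::field) \<Rightarrow> ('v \<Rightarrow> 'k) \<Rightarrow> 'k mpol" where
  "linear_form N x \<phi> = (\<Sum>j<N. mconst (coords N x \<phi> j) * mvar j)"

definition poly_act ::
  "('g, 'b) monoid_scheme \<Rightarrow> ('g \<Rightarrow> 'v \<Rightarrow> 'v) \<Rightarrow> nat \<Rightarrow> (nat \<Rightarrow> 'v \<Rightarrow> 'k::field) \<Rightarrow> 'g \<Rightarrow> 'k mpol \<Rightarrow> 'k mpol"
  where
  "poly_act G \<rho> N x g p =
     (\<Sum>m \<in> Poly_Mapping.keys p. mconst (Poly_Mapping.lookup p m) *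
        (\<Prod>i \<in> Poly_Mapping.keys m. linear_form N x (dual_act G \<rho> g (x i)) ^ Poly_Mapping.lookup m i))"

definition ratfun_act ::
  "('g, 'b) monoid_scheme \<Rightarrow> ('g \<Rightarrow> 'v \<Rightarrow> 'v) \<Rightarrow> nat \<Rightarrow> (nat \<Rightarrow> 'v \<Rightarrow> 'k::field) \<Rightarrow> 'g \<Rightarrow> 'k ratf \<Rightarrow> 'k ratf"
  where
  "ratfun_act G \<rho> N x g f =
     (THE h. \<exists>p \<in> polys N. \<exists>q \<in> polys N. q \<noteq> 0 \<and> f = Fract p q \<and>
        h = Fract (poly_act G \<rho> N x g p) (poly_act G \<rho> N x g q))"

definition inv_field ::
  "('g, 'b) monoid_scheme \<Rightarrow> ('g \<Rightarrow> 'v \<Rightarrow> 'v) \<Rightarrow> nat \<Rightarrow> (nat \<Rightarrow> 'v \<Rightarrow> 'k::field) \<Rightarrow> 'k ratf set" where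
  "inv_field G \<rho> N x = {f \<in> ratfuns N. \<forall>g \<in> carrier G. ratfun_act G \<rho> N x g f = f}"

definition inv_field_le ::
  "('g, 'b) monoid_scheme \<Rightarrow> ('g \<Rightarrow> 'v \<Rightarrow> 'v) \<Rightarrow> nat \<Rightarrow> (nat \<Rightarrow> 'v \<Rightarrow> 'k::field) \<Rightarrow> nat \<Rightarrow> 'k ratf set" where
  "inv_field_le G \<rho> N x d = {f \<in> inv_field G \<rho> N x. ratfun_degree N f \<le> d}"


section \<open>Field generation, transcendence bases and the two degree bounds\<close>

definition is_subfield :: "'a::field set \<Rightarrow> bool" where
  "is_subfield K \<longleftrightarrow> 0 \<in> K \<and> 1 \<in> K \<and>
     (\<forall>a \<in> K. \<forall>b \<in> K. a + b \<in> K \<and> a * b \<in> K) \<and> (\<forall>a \<in> K. - a \<in> K \<and> inverse a \<in> K)"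

text \<open>The field generated by \<open>S\<close> over the ground field.\<close>

definition field_adjoin :: "'k::field ratf set \<Rightarrow> 'k ratf set" where
  "field_adjoin S = \<Inter>{K. is_subfield K \<and> range rconst \<subseteq> K \<and> S \<subseteq> K}"

text \<open>In the next definition the elements of \<open>B\<close> themselves serve as names of the variables of \<open>P\<close>.\<close>

definition alg_independent :: "'k::field ratf set \<Rightarrow> bool" where
  "alg_independent B \<longleftrightarrow>
     (\<forall>P :: ('k ratf \<Rightarrow>\<^sub>0 nat) \<Rightarrow>\<^sub>0 'k.
        (\<forall>m \<in> Poly_Mapping.keys P. Poly_Mapping.keys m \<subseteq> B) \<and>
        (\<Sum>m \<in> Poly_Mapping.keys P. rconst (Poly_Mapping.lookup P m) *
           (\<Prod>b \<in> Poly_Mapping.keys m. b ^ Poly_Mapping.lookup m b)) = 0 \<longrightarrow> P = 0)"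

definition algebraic_over :: "'a::field set \<Rightarrow> 'a \<Rightarrow> bool" where
  "algebraic_over K y \<longleftrightarrow> (\<exists>p. p \<noteq> 0 \<and> (\<forall>i. coeff p i \<in> K) \<and> poly p y = 0)"

definition transcendence_basis :: "'k::field ratf set \<Rightarrow> 'k ratf set \<Rightarrow> bool" where
  "transcendence_basis F B \<longleftrightarrow>
     B \<subseteq> F \<and> alg_independent B \<and> (\<forall>y \<in> F. algebraic_over (field_adjoin B) y)"

definition beta_field ::
  "('g, 'b) monoid_scheme \<Rightarrow> ('g \<Rightarrow> 'v \<Rightarrow> 'v) \<Rightarrow> nat \<Rightarrow> (nat \<Rightarrow> 'v \<Rightarrow> 'k::field) \<Rightarrow> nat" where
  "beta_field G \<rho> N x =
     (LEAST d. 0 < d \<and> field_adjoin (inv_field_le G \<rho> N x d) = inv_field G \<rho> N x)"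

definition gamma_field ::
  "('g, 'b) monoid_scheme \<Rightarrow> ('g \<Rightarrow> 'v \<Rightarrow> 'v) \<Rightarrow> nat \<Rightarrow> (nat \<Rightarrow> 'v \<Rightarrow> 'k::field) \<Rightarrow> nat" where
  "gamma_field G \<rho> N x =
     (LEAST d. 0 < d \<and>
        (\<exists>B \<subseteq> inv_field_le G \<rho> N x d. transcendence_basis (inv_field G \<rho> N x) B))"


section \<open>The lattice of invariant Laurent monomials\<close>

text \<open>\<open>\<int>\<^sup>N\<close> is the set of those \<open>a :: nat \<Rightarrow>\<^sub>0 int\<close> whose support lies in \<open>{..<N}\<close>.\<close>

definition laurent_monomial :: "nat \<Rightarrow> (nat \<Rightarrow>\<^sub>0 int) \<Rightarrow> 'k::field ratf" where
  "laurent_monomial N a = (\<Prod>i<N. Fract (mvar i) 1 powi Poly_Mapping.lookup a i)"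

definition inv_lattice ::
  "('g, 'b) monoid_scheme \<Rightarrow> ('g \<Rightarrow> 'v \<Rightarrow> 'v) \<Rightarrow> nat \<Rightarrow> (nat \<Rightarrow> 'v \<Rightarrow> 'k::field) \<Rightarrow> (nat \<Rightarrow>\<^sub>0 int) set"
  where
  "inv_lattice G \<rho> N x =
     {a. Poly_Mapping.keys a \<subseteq> {..<N} \<and>
         (\<forall>g \<in> carrier G. ratfun_act G \<rho> N x g (laurent_monomial N a) = laurent_monomial N a)}"

definition cross_polytope :: "nat \<Rightarrow> (nat \<Rightarrow> real) set" where
  "cross_polytope N = {u. (\<forall>i\<ge>N. u i = 0) \<and> (\<Sum>i<N. \<bar>u i\<bar>) \<le> 1}"

definition lattice_points :: "nat \<Rightarrow> nat \<Rightarrow> (nat \<Rightarrow>\<^sub>0 int) set" where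
  "lattice_points N d =
     {a. \<exists>u \<in> cross_polytope N. \<forall>i. of_int (Poly_Mapping.lookup a i) = real d * u i}"

text \<open>
  The rank of a subgroup of \<open>\<int>\<^sup>N\<close>: the largest size of a subset that is linearly independent
  over the integers (\<open>frag_cmul\<close> is the multiplication by integers on \<open>nat \<Rightarrow>\<^sub>0 int\<close>).
\<close>

definition lattice_rank :: "(nat \<Rightarrow>\<^sub>0 int) set \<Rightarrow> nat" where
  "lattice_rank H = Max {card B | B. finite B \<and> B \<subseteq> H \<and> \<not> module.dependent frag_cmul B}"

end

theory Submission
  imports Defs
begin

text \<open>
  Both equalities hold because the two sides minimise over the same set of \<open>d > 0\<close>. Write \<open>L\<close> for
  the lattice of invariant Laurent monomials and \<open>H\<^sub>d\<close> for the subgroup of \<open>L\<close> generated by its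
  points in \<open>d\<Omega>\<^sub>N\<close>. The bridge between fields and lattices is the field \<open>coset_fractions N H\<close> of
  all quotients \<open>p/q\<close> whose monomials, in numerator and denominator, lie in one coset of a
  subgroup \<open>H\<close> of \<open>\<int>\<^sup>N\<close>. It is the field generated by the Laurent monomials with exponent in \<open>H\<close>
  (\<open>field_adjoin_laurent_monomials\<close>), and a Laurent monomial lies in it only if its exponent lies in
  \<open>H\<close> (\<open>laurent_monomial_mem_iff\<close>), so that the field determines \<open>H\<close>.

  The central fact is that the invariants of degree at most \<open>d\<close> generate exactly the field of \<open>H\<^sub>d\<close>
  (\<open>field_adjoin_inv_field_le\<close>). On the one hand \<open>x\<^sup>a\<close> has degree \<open>\<Sum>\<bar>a\<^sub>i\<bar>\<close>. On the other hand, let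
  \<open>f = p/q\<close> be invariant with \<open>deg p + deg q \<le> d\<close>. In \<open>p = f q\<close> the factor \<open>f\<close> is fixed by \<open>G\<close>, so
  projecting both sides to the isotypic component of a character \<open>\<chi>\<close> of \<open>G\<close> yields
  \<open>p\<^sub>\<chi> = f q\<^sub>\<chi>\<close>. If \<open>\<chi>\<close> is the character of a monomial of \<open>q\<close>, then \<open>f = p\<^sub>\<chi>/q\<^sub>\<chi>\<close>, where the
  quotient of a monomial of \<open>p\<^sub>\<chi>\<close> by one of \<open>q\<^sub>\<chi>\<close> is an invariant Laurent monomial with exponent in
  \<open>d\<Omega>\<^sub>N\<close>. The argument applies to every representation \<open>p/q\<close> of \<open>f\<close>, reduced or not.

  It follows that the whole invariant field is the field of \<open>L\<close>, and that it is generated by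
  invariants of degree at most \<open>d\<close> iff \<open>H\<^sub>d = L\<close>: this is the claim on \<open>beta_field\<close>.

  For \<open>gamma_field\<close>, full rank of \<open>H\<^sub>d\<close> is used in the form that \<open>H\<^sub>d\<close> contains a positive
  multiple of each unit vector (\<open>lattice_rank_eq_iff\<close>). Suppose that all invariants are
  algebraic over the field of \<open>H\<^sub>d\<close>. Laurent monomials from distinct cosets of \<open>H\<^sub>d\<close> are
  linearly independent over that field (\<open>laurent_monomials_independent_mod\<close>), so an algebraic
  equation for \<open>x\<^sup>a\<close> forces two powers of \<open>x\<^sup>a\<close> into the same coset, and a positive multiple of
  \<open>a\<close> lies in \<open>H\<^sub>d\<close>; this applies to \<open>|G|\<close> times a unit vector. Conversely, if \<open>H\<^sub>d\<close> has full
  rank, choose a maximal independent set \<open>B\<close> of points of \<open>L\<close> in \<open>d\<Omega>\<^sub>N\<close>; it generates a group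
  of full rank again. The Laurent monomials with exponent in \<open>B\<close> are algebraically independent,
  because distinct products of them are distinct Laurent monomials. Every rational function is
  algebraic over the field that they generate, because the polynomials lie in the linear span
  of finitely many monomials over it (\<open>ratfuns_algebraic\<close>).
\<close>

section \<open>Linear algebra over a subfield\<close>

lemma is_subfield_sum:
  assumes "is_subfield K" "\<And>i. i \<in> I \<Longrightarrow> f i \<in> K"
  shows "sum f I \<in> K"
  using assms(2) by (induction I rule: infinite_finite_induct) (use assms(1) in \<open>auto simp: is_subfield_def\<close>)

lemma is_subfield_divide: "is_subfield K \<Longrightarrow> a \<in> K \<Longrightarrow> b \<in> K \<Longrightarrow> a / b \<in> K"
  by (auto simp: is_subfield_def divide_inverse)

lemma is_subfield_diff: "is_subfield K \<Longrightarrow> a \<in> K \<Longrightarrow> b \<in> K \<Longrightarrow> a - b \<in> K"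
  unfolding is_subfield_def by (metis add_uminus_conv_diff)

lemma is_subfield_mult: "is_subfield K \<Longrightarrow> a \<in> K \<Longrightarrow> b \<in> K \<Longrightarrow> a * b \<in> K"
  by (auto simp: is_subfield_def)

text \<open>
  Gaussian elimination: one unknown is solved for in one equation and eliminated from the others.
  It is stated relative to a subfield because it serves twice: over the field of a lattice inside
  the field of rational functions, and over the rational numbers to bound the rank of a lattice.
\<close>

lemma homogeneous_system_nontrivial_solution:
  fixes c :: "'i \<Rightarrow> 'd \<Rightarrow> 'a::field"
  assumes K: "is_subfield K" and "finite D" and "finite I" and "card D < card I"
    and "\<And>i d. i \<in> I \<Longrightarrow> d \<in> D \<Longrightarrow> c i d \<in> K"
  shows "\<exists>u. (\<forall>i\<in>I. u i \<in> K) \<and> (\<exists>i\<in>I. u i \<noteq> 0) \<and> (\<forall>d\<in>D. (\<Sum>i\<in>I. u i * c i d) = 0)"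
  using assms(2-)
proof (induction D arbitrary: I c rule: finite_induct)
  case empty
  then have "I \<noteq> {}" by auto
  with K show ?case by (intro exI[of _ "\<lambda>_. 1"]) (auto simp: is_subfield_def)
next
  case (insert d D)
  show ?case
  proof (cases "\<forall>i\<in>I. c i d = 0")
    case True
    have "card D < card I" using insert.prems insert.hyps by simp
    then obtain u where "\<forall>i\<in>I. u i \<in> K" "\<exists>i\<in>I. u i \<noteq> 0" "\<forall>d\<in>D. (\<Sum>i\<in>I. u i * c i d) = 0"
      using insert.IH[of I c] insert.prems by auto
    with True show ?thesis by (intro exI[of _ u]) auto
  next
    case False
    then obtain j where j: "j \<in> I" "c j d \<noteq> 0" by auto
    define J where "J = I - {j}"
    have I: "I = insert j J" "j \<notin> J" "finite J" using j insert.prems by (auto simp: J_def)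
    define c' where "c' i e = c i e - c i d / c j d * c j e" for i e
    have "card D < card J" using insert.prems insert.hyps I by simp
    moreover have "c' i e \<in> K" if "i \<in> J" "e \<in> D" for i e
      unfolding c'_def using that I K insert.prems(3)
      by (intro is_subfield_diff is_subfield_mult is_subfield_divide) auto
    ultimately obtain u where u: "\<forall>i\<in>J. u i \<in> K" "\<exists>i\<in>J. u i \<noteq> 0"
        "\<forall>e\<in>D. (\<Sum>i\<in>J. u i * c' i e) = 0"
      using insert.IH[of J c'] I by blast
    define w where "w = (\<Sum>i\<in>J. u i * (c i d / c j d))"
    define v where "v = u(j := - w)"
    have "w \<in> K" unfolding w_def using u I K insert.prems(3)
      by (intro is_subfield_sum is_subfield_mult is_subfield_divide) auto
    then have "\<forall>i\<in>I. v i \<in> K" using u I K by (auto simp: v_def is_subfield_def)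
    moreover have "\<exists>i\<in>I. v i \<noteq> 0" using u I by (auto simp: v_def)
    moreover have eq: "(\<Sum>i\<in>I. v i * c i e) = (\<Sum>i\<in>J. u i * c' i e)" for e
    proof -
      have "(\<Sum>i\<in>I. v i * c i e) = v j * c j e + (\<Sum>i\<in>J. v i * c i e)" using I by simp
      also have "(\<Sum>i\<in>J. v i * c i e) = (\<Sum>i\<in>J. u i * c i e)"
        using I by (intro sum.cong) (auto simp: v_def)
      also have "v j * c j e = (\<Sum>i\<in>J. - (u i * (c i d / c j d * c j e)))"
        by (simp add: v_def w_def sum_distrib_left sum_distrib_right sum_negf algebra_simps)
      finally show ?thesis
        by (simp add: c'_def sum.distrib[symmetric] algebra_simps sum_subtractf)
    qed
    moreover have "(\<Sum>i\<in>J. u i * c' i d) = 0" using j by (simp add: c'_def)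
    ultimately show ?thesis using u by (intro exI[of _ v]) auto
  qed
qed


section \<open>Monomials and exponent vectors\<close>

abbreviation "keys \<equiv> Poly_Mapping.keys"
abbreviation "lookup \<equiv> Poly_Mapping.lookup"

abbreviation mon :: "(nat \<Rightarrow>\<^sub>0 nat) \<Rightarrow> 'k::field mpol" where
  "mon m \<equiv> Poly_Mapping.single m 1"

definition iexp :: "(nat \<Rightarrow>\<^sub>0 nat) \<Rightarrow> (nat \<Rightarrow>\<^sub>0 int)" where
  "iexp = Poly_Mapping.map int"

definition pos_exp :: "(nat \<Rightarrow>\<^sub>0 int) \<Rightarrow> (nat \<Rightarrow>\<^sub>0 nat)" where
  "pos_exp = Poly_Mapping.map nat"

lemma lookup_iexp [simp]: "lookup (iexp m) i = int (lookup m i)"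
  unfolding iexp_def by transfer (auto simp: when_def)

lemma lookup_pos_exp [simp]: "lookup (pos_exp a) i = nat (lookup a i)"
  unfolding pos_exp_def by transfer (auto simp: when_def)

lemma keys_iexp [simp]: "keys (iexp m) = keys m"
  by (auto simp: in_keys_iff)

lemma keys_pos_exp: "keys (pos_exp a) \<subseteq> keys a"
  by (auto simp: in_keys_iff)

lemma iexp_add: "iexp (m + n) = iexp m + iexp n"
  by (rule poly_mapping_eqI) (simp add: lookup_add)

lemma iexp_0 [simp]: "iexp 0 = 0"
  by (rule poly_mapping_eqI) simp

lemma pos_exp_decomp: "iexp (pos_exp a) - iexp (pos_exp (- a)) = a"
  by (rule poly_mapping_eqI) (simp add: lookup_minus)

text \<open>
  No cancellation occurs when a polynomial is multiplied by a monomial: its exponents are shifted.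
\<close>

lemma keys_mon_mult:
  fixes p :: "'k::field mpol"
  shows "keys (mon m * p) = (+) m ` keys p"
proof -
  have eq: "lookup (mon m * p) (m + n) = lookup p n" for n
    by (simp add: lookup_mult lookup_single when_mult)
  have "keys (mon m * p) \<subseteq> (+) m ` keys p"
    using keys_mult[of "mon m" p] by (auto split: if_splits)
  moreover have "(+) m ` keys p \<subseteq> keys (mon m * p)"
    by (auto simp: in_keys_iff eq)
  ultimately show ?thesis by blast
qed

lemma mon_nonzero [simp]: "mon m \<noteq> (0 :: 'k::field mpol)"
  by (metis lookup_single_eq lookup_zero one_neq_zero)

lemma poly_eq_sum_single:
  "p = (\<Sum>m\<in>keys p. Poly_Mapping.single m (lookup p m))"
  by (rule poly_mapping_eqI)
     (auto simp: lookup_sum lookup_single when_def not_in_keys_iff_lookup_eq_zero)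

lemma to_fract_eq_sum:
  fixes p :: "'k::field mpol"
  shows "to_fract p = (\<Sum>m\<in>keys p. rconst (lookup p m) * to_fract (mon m))"
proof -
  have "to_fract p = (\<Sum>m\<in>keys p. to_fract (Poly_Mapping.single m (lookup p m)))"
    by (subst poly_eq_sum_single) (simp only: to_fract_sum)
  also have "\<dots> = (\<Sum>m\<in>keys p. rconst (lookup p m) * to_fract (mon m))"
    by (simp add: rconst_def mconst_def mult_single flip: to_fract_def to_fract_mult)
  finally show ?thesis .
qed

lemma single_in_polys: "keys m \<subseteq> {..<N} \<Longrightarrow> Poly_Mapping.single m c \<in> polys N"
  by (auto simp: polys_def)

lemma zero_in_polys: "0 \<in> polys N" and one_in_polys: "1 \<in> polys N"
  by (auto simp: polys_def)

lemma polys_add: "p \<in> polys N \<Longrightarrow> q \<in> polys N \<Longrightarrow> p + q \<in> polys N"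
  using keys_add[of p q] by (fastforce simp: polys_def)

lemma polys_uminus: "p \<in> polys N \<Longrightarrow> - p \<in> polys N"
  by (auto simp: polys_def)

lemma polys_mult:
  fixes p :: "'k::field mpol"
  assumes "p \<in> polys N" "q \<in> polys N" shows "p * q \<in> polys N"
  unfolding polys_def
proof safe
  fix m i assume "m \<in> keys (p * q)" and i: "i \<in> keys m"
  then obtain a b where "a \<in> keys p" "b \<in> keys q" "m = a + b"
    using keys_mult[of p q] by auto
  then show "i < N" using i keys_add[of a b] assms by (fastforce simp: polys_def)
qed

lemma polys_power: "p \<in> polys N \<Longrightarrow> p ^ n \<in> polys N"
  by (induction n) (auto simp: one_in_polys polys_mult)

lemma polys_sum: "(\<And>i. i \<in> I \<Longrightarrow> f i \<in> polys N) \<Longrightarrow> sum f I \<in> polys N"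
  by (induction I rule: infinite_finite_induct) (auto simp: zero_in_polys polys_add)

lemma polys_keys: "p \<in> polys N \<Longrightarrow> m \<in> keys p \<Longrightarrow> keys m \<subseteq> {..<N}"
  by (auto simp: polys_def)

lemma laurent_monomial_add:
  "laurent_monomial N (a + b) = (laurent_monomial N a * laurent_monomial N b :: 'k::field ratf)"
proof -
  have "Fract (mvar i :: 'k mpol) 1 \<noteq> 0" for i
    by (simp add: mvar_def flip: to_fract_def)
  then show ?thesis
    by (simp add: laurent_monomial_def lookup_add power_int_add prod.distrib)
qed

lemma laurent_monomial_uminus:
  "laurent_monomial N (- a) = inverse (laurent_monomial N a)"
  by (simp add: laurent_monomial_def power_int_minus flip: prod_inversef)

lemma laurent_monomial_0 [simp]: "laurent_monomial N 0 = 1"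
  by (simp add: laurent_monomial_def)

lemma laurent_monomial_diff:
  "laurent_monomial N (a - b) = laurent_monomial N a / laurent_monomial N b"
  using laurent_monomial_add[of N a "- b"] by (simp add: laurent_monomial_uminus divide_inverse)

lemma single_eq_prod_vars:
  assumes "keys m \<subseteq> {..<N}"
  shows "mon m = (\<Prod>i<N. (mvar i :: 'k::field mpol) ^ lookup m i)"
proof -
  have pow: "(mvar i :: 'k mpol) ^ n = mon (Poly_Mapping.single i n)" for i n
    by (induction n) (simp_all add: mvar_def mult_single flip: single_add)
  have "(\<Prod>i<N. mon (Poly_Mapping.single i (lookup m i)) :: 'k mpol)
      = mon (\<Sum>i<N. Poly_Mapping.single i (lookup m i))" for N
    by (induction N) (simp_all add: mult_single add.commute)
  moreover have "(\<Sum>i<N. Poly_Mapping.single i (lookup m i)) = m"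
    using assms
    by (intro poly_mapping_eqI)
       (force simp: lookup_sum lookup_single when_def not_in_keys_iff_lookup_eq_zero)
  ultimately show ?thesis by (simp add: pow)
qed

lemma to_fract_prod: "to_fract (prod f I) = prod (\<lambda>i. to_fract (f i)) I"
  by (induction I rule: infinite_finite_induct) auto

lemma to_fract_power: "to_fract (p ^ n) = to_fract p ^ n"
  by (induction n) auto

lemma to_fract_mon:
  assumes "keys m \<subseteq> {..<N}"
  shows "to_fract (mon m :: 'k::field mpol) = laurent_monomial N (iexp m)"
  using assms
  by (simp add: single_eq_prod_vars laurent_monomial_def to_fract_prod to_fract_power flip: to_fract_def)

lemma laurent_monomial_eq_Fract:
  assumes "keys a \<subseteq> {..<N}"
  shows "(laurent_monomial N a :: 'k::field ratf) = Fract (mon (pos_exp a)) (mon (pos_exp (- a)))"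
proof -
  have "keys (pos_exp a) \<subseteq> {..<N}" "keys (pos_exp (- a)) \<subseteq> {..<N}"
    using assms keys_pos_exp[of a] keys_pos_exp[of "- a"] by auto
  then show ?thesis
    by (subst pos_exp_decomp[symmetric, of a])
       (simp add: laurent_monomial_diff Fract_conv_to_fract to_fract_mon)
qed

lemma laurent_monomial_nonzero [simp]: "laurent_monomial N a \<noteq> (0 :: 'k::field ratf)"
  using laurent_monomial_add[of N a "- a", where 'k = 'k] by auto

lemma laurent_monomial_sum:
  "laurent_monomial N (sum f I) = (\<Prod>i\<in>I. laurent_monomial N (f i))"
  by (induction I rule: infinite_finite_induct) (auto simp: laurent_monomial_add)

section \<open>Fractions supported on one coset of a group of exponents\<close>

definition congruent_exps :: "(nat \<Rightarrow>\<^sub>0 int) set \<Rightarrow> (nat \<Rightarrow>\<^sub>0 nat) set \<Rightarrow> bool" where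
  "congruent_exps H M \<longleftrightarrow> (\<forall>m\<in>M. \<forall>n\<in>M. iexp m - iexp n \<in> H)"

text \<open>
  For a subgroup \<open>H\<close> of \<open>\<int>\<^sup>N\<close> this is the field generated by the Laurent monomials with exponent in
  \<open>H\<close>. Allowing the exponents to lie in any one coset, and not only in \<open>H\<close> itself, permits
  numerators and denominators to be ordinary polynomials.
\<close>

definition coset_fractions :: "nat \<Rightarrow> (nat \<Rightarrow>\<^sub>0 int) set \<Rightarrow> 'k::field ratf set" where
  "coset_fractions N H =
     {Fract p q | p q. p \<in> polys N \<and> q \<in> polys N \<and> q \<noteq> 0 \<and>
        congruent_exps H (keys p \<union> keys q)}"

lemma congruent_exps_mono: "congruent_exps H M \<Longrightarrow> M' \<subseteq> M \<Longrightarrow> congruent_exps H M'"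
  by (auto simp: congruent_exps_def)

lemma keys_mult_subset:
  assumes "keys u \<subseteq> M" "keys v \<subseteq> M'"
  shows "keys (u * v) \<subseteq> {m + m' | m m'. m \<in> M \<and> m' \<in> M'}"
  using keys_mult[of u v] assms by fastforce

locale exponent_group =
  fixes N :: nat and H :: "(nat \<Rightarrow>\<^sub>0 int) set"
  assumes zero_mem: "0 \<in> H"
    and diff_mem: "\<And>a b. a \<in> H \<Longrightarrow> b \<in> H \<Longrightarrow> a - b \<in> H"
    and supported: "\<And>a. a \<in> H \<Longrightarrow> keys a \<subseteq> {..<N}"
begin

lemma uminus_mem: "a \<in> H \<Longrightarrow> - a \<in> H"
  using diff_mem[OF zero_mem, of a] by simp

lemma add_mem: "a \<in> H \<Longrightarrow> b \<in> H \<Longrightarrow> a + b \<in> H"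
  using diff_mem[OF _ uminus_mem, of a b] by simp

lemma frag_cmul_mem: "a \<in> H \<Longrightarrow> frag_cmul k a \<in> H"
  by (rule frag_closure_minus_cmul) (auto simp: zero_mem diff_mem)

lemma sum_mem: "(\<And>i. i \<in> I \<Longrightarrow> f i \<in> H) \<Longrightarrow> sum f I \<in> H"
  by (induction I rule: infinite_finite_induct) (auto simp: zero_mem add_mem)

text \<open>
  The sum of two cosets is a coset. This makes \<open>coset_fractions N H\<close> closed under addition and
  multiplication.
\<close>

lemma congruent_exps_plus:
  assumes "congruent_exps H M" "congruent_exps H M'"
  shows "congruent_exps H {m + m' | m m'. m \<in> M \<and> m' \<in> M'}"
  unfolding congruent_exps_def
proof safe
  fix m m' n n' assume "m \<in> M" "m' \<in> M'" "n \<in> M" "n' \<in> M'"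
  then have "(iexp m - iexp n) + (iexp m' - iexp n') \<in> H"
    using assms by (intro add_mem) (auto simp: congruent_exps_def)
  then show "iexp (m + m') - iexp (n + n') \<in> H" by (simp add: iexp_add algebra_simps)
qed

lemma coset_fractions_subset_ratfuns: "coset_fractions N H \<subseteq> ratfuns N"
  by (auto simp: coset_fractions_def ratfuns_def)

lemma coset_fractionsI:
  assumes "p \<in> polys N" "q \<in> polys N" "q \<noteq> 0"
    "congruent_exps H (keys p \<union> keys q)"
  shows "Fract p q \<in> coset_fractions N H"
  using assms by (auto simp: coset_fractions_def)

lemma coset_fractions_binop:
  assumes f: "f \<in> coset_fractions N H" and g: "g \<in> coset_fractions N H"
  shows "f + g \<in> coset_fractions N H" "f * g \<in> coset_fractions N H"
proof -
  obtain p q where pq: "p \<in> polys N" "q \<in> polys N" "q \<noteq> 0" "f = Fract p q"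
    and M: "congruent_exps H (keys p \<union> keys q)" (is "congruent_exps H ?M")
    using f by (auto simp: coset_fractions_def)
  obtain r s where rs: "r \<in> polys N" "s \<in> polys N" "s \<noteq> 0" "g = Fract r s"
    and M': "congruent_exps H (keys r \<union> keys s)" (is "congruent_exps H ?M'")
    using g by (auto simp: coset_fractions_def)
  let ?S = "{m + m' | m m'. m \<in> ?M \<and> m' \<in> ?M'}"
  note S = congruent_exps_plus[OF M M']
  have K: "keys (u * v) \<subseteq> ?S" if "u = p \<or> u = q" "v = r \<or> v = s" for u v
    using that by (intro keys_mult_subset) auto
  have "keys (p * s + r * q) \<subseteq> ?S"
    using keys_add[of "p * s" "r * q"] K[of p s] K[of q r] by (auto simp: mult.commute)
  then have "congruent_exps H (keys (p * s + r * q) \<union> keys (q * s))"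
    using K[of q s] by (intro congruent_exps_mono[OF S]) auto
  then have "Fract (p * s + r * q) (q * s) \<in> coset_fractions N H"
    using pq rs by (intro coset_fractionsI polys_add polys_mult) auto
  with pq rs show "f + g \<in> coset_fractions N H" by simp
  have "congruent_exps H (keys (p * r) \<union> keys (q * s))"
    using K[of p r] K[of q s] by (intro congruent_exps_mono[OF S]) auto
  then have "Fract (p * r) (q * s) \<in> coset_fractions N H"
    using pq rs by (intro coset_fractionsI polys_mult) auto
  with pq rs show "f * g \<in> coset_fractions N H" by simp
qed

lemma rconst_mem: "rconst c \<in> coset_fractions N H"
  unfolding rconst_def mconst_def
  by (rule coset_fractionsI) (auto simp: single_in_polys one_in_polys congruent_exps_def zero_mem split: if_splits)

lemma is_subfield_coset_fractions: "is_subfield (coset_fractions N H :: 'k::field ratf set)"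
proof -
  have "rconst 0 = (0 :: 'k ratf)" "rconst 1 = (1 :: 'k ratf)"
    by (simp_all add: rconst_def mconst_def flip: to_fract_def)
  then have "0 \<in> (coset_fractions N H :: 'k ratf set)" "1 \<in> (coset_fractions N H :: 'k ratf set)"
    using rconst_mem[of "0 :: 'k"] rconst_mem[of "1 :: 'k"] by simp_all
  moreover have "- f \<in> coset_fractions N H" "inverse f \<in> coset_fractions N H"
    if f: "f \<in> coset_fractions N H" for f :: "'k ratf"
  proof -
    obtain p q where pq: "p \<in> polys N" "q \<in> polys N" "q \<noteq> 0" "f = Fract p q"
      and M: "congruent_exps H (keys p \<union> keys q)"
      using f by (auto simp: coset_fractions_def)
    have "Fract (- p) q \<in> coset_fractions N H"
      using pq M by (intro coset_fractionsI) (auto simp: polys_uminus)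
    with pq show "- f \<in> coset_fractions N H" by simp
    show "inverse f \<in> coset_fractions N H"
    proof (cases "p = 0")
      case True
      then have "inverse f = 0" using pq by (simp add: Fract_conv_to_fract)
      then show ?thesis using \<open>0 \<in> coset_fractions N H\<close> by simp
    next
      case False
      then show ?thesis using pq M by (auto intro!: coset_fractionsI simp: Un_commute)
    qed
  qed
  ultimately show ?thesis by (auto simp: is_subfield_def coset_fractions_binop)
qed

text \<open>
  If \<open>x\<^sup>a = p/q\<close>, a monomial of \<open>x\<^sup>a q = p\<close> gives exponents \<open>n\<close> of \<open>q\<close> and \<open>m\<close> of \<open>p\<close> with
  \<open>a = m - n\<close>. Hence \<open>H\<close> can be recovered from its field.
\<close>

lemma laurent_monomial_mem_iff:
  assumes a: "keys a \<subseteq> {..<N}"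
  shows "(laurent_monomial N a :: 'k::field ratf) \<in> coset_fractions N H \<longleftrightarrow> a \<in> H"
proof
  have k: "keys (pos_exp a) \<subseteq> {..<N}" "keys (pos_exp (- a)) \<subseteq> {..<N}"
    using a keys_pos_exp[of a] keys_pos_exp[of "- a"] by auto
  {
    assume "a \<in> H"
    moreover have "iexp (pos_exp (- a)) - iexp (pos_exp a) = - a"
      using pos_exp_decomp[of a] by (metis minus_diff_eq)
    ultimately show "(laurent_monomial N a :: 'k ratf) \<in> coset_fractions N H"
      unfolding laurent_monomial_eq_Fract[OF a] using k
      by (intro coset_fractionsI) (auto simp: single_in_polys congruent_exps_def zero_mem pos_exp_decomp uminus_mem)
  }
  assume "(laurent_monomial N a :: 'k ratf) \<in> coset_fractions N H"
  then obtain p q :: "'k mpol" where pq: "q \<noteq> 0" "laurent_monomial N a = Fract p q"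
    and M: "congruent_exps H (keys p \<union> keys q)"
    by (auto simp: coset_fractions_def)
  then have "mon (pos_exp a) * q = mon (pos_exp (- a)) * p"
    by (simp add: laurent_monomial_eq_Fract[OF a] eq_fract mult.commute)
  from arg_cong[OF this, of keys]
  have "(+) (pos_exp a) ` keys q = (+) (pos_exp (- a)) ` keys p"
    by (simp only: keys_mon_mult)
  moreover obtain n where n: "n \<in> keys q" using pq(1) by (metis keys_eq_empty all_not_in_conv)
  ultimately have "pos_exp a + n \<in> (+) (pos_exp (- a)) ` keys p" by blast
  then obtain m where m: "m \<in> keys p" "pos_exp a + n = pos_exp (- a) + m" by blast
  from m(2) have "iexp (pos_exp a) + iexp n = iexp (pos_exp (- a)) + iexp m" by (metis iexp_add)
  then have "iexp m - iexp n = a" using pos_exp_decomp[of a] by (simp add: algebra_simps)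
  with M m n show "a \<in> H" by (auto simp: congruent_exps_def)
qed

text \<open>
  Dividing numerator and denominator by one monomial of the denominator turns both into linear
  combinations of Laurent monomials with exponents in \<open>H\<close>.
\<close>

lemma coset_fractions_subset_subfield:
  assumes F: "is_subfield F" "range rconst \<subseteq> F" "laurent_monomial N ` H \<subseteq> F"
  shows "(coset_fractions N H :: 'k::field ratf set) \<subseteq> F"
proof
  fix f :: "'k ratf" assume "f \<in> coset_fractions N H"
  then obtain p q where pq: "p \<in> polys N" "q \<in> polys N" "q \<noteq> 0" "f = Fract p q"
    and M: "congruent_exps H (keys p \<union> keys q)"
    by (auto simp: coset_fractions_def)
  obtain n where n: "n \<in> keys q" using pq(3) by (metis keys_eq_empty all_not_in_conv)
  have *: "to_fract r / laurent_monomial N (iexp n) \<in> F"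
    if r: "r \<in> polys N" "keys r \<subseteq> keys p \<union> keys q" for r
  proof -
    have "to_fract r / laurent_monomial N (iexp n) =
      (\<Sum>m\<in>keys r. rconst (lookup r m) * laurent_monomial N (iexp m - iexp n))"
      unfolding to_fract_eq_sum[of r] sum_divide_distrib
      using polys_keys[OF r(1)]
      by (intro sum.cong) (simp_all add: to_fract_mon[of _ N] laurent_monomial_diff)
    also have "\<dots> \<in> F"
    proof (intro is_subfield_sum[OF F(1)] is_subfield_mult[OF F(1)])
      fix m assume "m \<in> keys r"
      then have "iexp m - iexp n \<in> H" using M n r(2) by (auto simp: congruent_exps_def)
      then show "laurent_monomial N (iexp m - iexp n) \<in> F" using F(3) by blast
    qed (use F(2) in auto)
    finally show ?thesis .
  qed
  have "f = (to_fract p / laurent_monomial N (iexp n)) / (to_fract q / laurent_monomial N (iexp n))"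
    using pq by (simp add: Fract_conv_to_fract)
  also have "\<dots> \<in> F" using pq by (intro is_subfield_divide[OF F(1)] *) auto
  finally show "f \<in> F" .
qed

lemma coset_fractions_common_denominator:
  fixes c :: "'i \<Rightarrow> 'k::field ratf"
  assumes "finite I" "\<And>i. i \<in> I \<Longrightarrow> c i \<in> coset_fractions N H"
  shows "\<exists>q P. q \<noteq> 0 \<and> (\<forall>i\<in>I. c i = Fract (P i) q \<and>
            congruent_exps H (keys (P i) \<union> keys q))"
  using assms
proof (induction I rule: finite_induct)
  case empty
  show ?case by (rule exI[of _ 1]) auto
next
  case (insert j I)
  then obtain q P where q: "q \<noteq> 0" and P: "\<And>i. i \<in> I \<Longrightarrow> c i = Fract (P i) q"
      "\<And>i. i \<in> I \<Longrightarrow> congruent_exps H (keys (P i) \<union> keys q)"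
    by auto
  obtain r s where rs: "s \<noteq> 0" "c j = Fract r s"
    and M: "congruent_exps H (keys r \<union> keys s)"
    using insert.prems[of j] by (auto simp: coset_fractions_def)
  have prod: "congruent_exps H (keys (u * v) \<union> keys (u' * v'))"
    if "congruent_exps H (keys u \<union> keys u')"
       "congruent_exps H (keys v \<union> keys v')"
    for u u' v v' :: "'k mpol"
    by (rule congruent_exps_mono[OF congruent_exps_plus[OF that]])
       (intro Un_least keys_mult_subset; simp)
  have qq: "congruent_exps H (keys q \<union> keys q)" if "i \<in> I" for i
    using P(2)[OF that] by (auto simp: congruent_exps_def)
  show ?case
  proof (cases "I = {}")
    case True
    with rs M show ?thesis by (intro exI[of _ s] exI[of _ "\<lambda>_. r"]) auto
  next
    case False
    then have cq: "congruent_exps H (keys q \<union> keys q)" using qq by auto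
    have cs: "congruent_exps H (keys s \<union> keys s)"
      using M by (auto simp: congruent_exps_def)
    show ?thesis
    proof (intro exI[of _ "q * s"] exI[of _ "\<lambda>i. if i = j then q * r else P i * s"] conjI ballI)
      show "q * s \<noteq> 0" using q rs by simp
      fix i assume i: "i \<in> insert j I"
      show "c i = Fract (if i = j then q * r else P i * s) (q * s)"
        using i q rs P(1) by (auto simp: eq_fract)
      show "congruent_exps H (keys (if i = j then q * r else P i * s) \<union> keys (q * s))"
        using i prod[OF cq M] prod[OF P(2) cs] by (cases "i = j") auto
    qed
  qed
qed

text \<open>
  Over a common denominator, and after a shift that makes all exponents nonnegative, the terms of
  the sum become polynomials. The exponents in the \<open>i\<close>-th of them lie in one coset of \<open>H\<close>, and these
  cosets are distinct, so the terms cannot cancel.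
\<close>

lemma laurent_monomials_independent_mod:
  fixes c :: "'i \<Rightarrow> 'k::field ratf"
  assumes "finite I" and c: "\<And>i. i \<in> I \<Longrightarrow> c i \<in> coset_fractions N H"
    and a: "\<And>i. i \<in> I \<Longrightarrow> keys (a i) \<subseteq> {..<N}"
    and distinct: "\<And>i j. i \<in> I \<Longrightarrow> j \<in> I \<Longrightarrow> i \<noteq> j \<Longrightarrow> a i - a j \<notin> H"
    and sum0: "(\<Sum>i\<in>I. c i * laurent_monomial N (a i)) = 0"
    and j: "j \<in> I"
  shows "c j = 0"
proof (rule ccontr)
  assume "c j \<noteq> 0"
  obtain q P where q: "q \<noteq> 0" and P: "\<And>i. i \<in> I \<Longrightarrow> c i = Fract (P i) q"
      "\<And>i. i \<in> I \<Longrightarrow> congruent_exps H (keys (P i) \<union> keys q)"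
    using coset_fractions_common_denominator[of I c] assms by blast
  \<comment> \<open>Multiplication by \<open>x\<^sup>s\<close> clears all negative exponents; \<open>b i\<close> is the shifted exponent.\<close>
  define s where "s = (\<Sum>i\<in>I. pos_exp (- a i))"
  define b where "b i = pos_exp (a i + iexp s)" for i
  have b: "iexp (b i) = a i + iexp s" if "i \<in> I" for i
  proof (rule poly_mapping_eqI)
    fix k
    have "nat (- lookup (a i) k) \<le> (\<Sum>i\<in>I. nat (- lookup (a i) k))"
      using \<open>finite I\<close> that by (intro member_le_sum) auto
    also have "\<dots> = lookup s k" by (simp add: s_def lookup_sum)
    finally show "lookup (iexp (b i)) k = lookup (a i + iexp s) k"
      by (simp add: b_def lookup_add)
  qed
  have s: "keys s \<subseteq> {..<N}"
    unfolding s_def using keys_sum[of "\<lambda>i. pos_exp (- a i)" I] keys_pos_exp a by fastforce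
  have bN: "keys (b i) \<subseteq> {..<N}" if "i \<in> I" for i
    using keys_add[of "a i" "iexp s"] a[OF that] s keys_iexp[of "b i"] by (simp add: b[OF that]) blast
  have tb: "to_fract (mon (b i)) = (laurent_monomial N (a i) * laurent_monomial N (iexp s) :: 'k ratf)"
    if "i \<in> I" for i
    using bN that by (simp add: to_fract_mon[of _ N] b laurent_monomial_add)
  have "to_fract (\<Sum>i\<in>I. mon (b i) * P i)
      = (\<Sum>i\<in>I. c i * laurent_monomial N (a i)) * laurent_monomial N (iexp s) * to_fract q"
    unfolding to_fract_sum sum_distrib_right
    using q by (intro sum.cong) (simp_all add: tb P(1) Fract_conv_to_fract)
  then have zero: "(\<Sum>i\<in>I. mon (b i) * P i) = 0"
    using sum0 by (simp only: mult_zero_left to_fract_eq_0_iff)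
  have "P j \<noteq> 0" using \<open>c j \<noteq> 0\<close> P(1)[OF j] by (auto simp: Fract_conv_to_fract)
  then obtain m where m: "m \<in> keys (P j)" by (metis keys_eq_empty all_not_in_conv)
  obtain n where n: "n \<in> keys q" using q by (metis keys_eq_empty all_not_in_conv)
  \<comment> \<open>A monomial of the \<open>j\<close>-th term occurs in no other term.\<close>
  have "b j + m \<notin> keys (mon (b i) * P i)" if i: "i \<in> I" "i \<noteq> j" for i
  proof
    assume "b j + m \<in> keys (mon (b i) * P i)"
    then obtain m' where m': "m' \<in> keys (P i)" "b j + m = b i + m'"
      by (auto simp: keys_mon_mult)
    from m'(2) have "iexp (b j) + iexp m = iexp (b i) + iexp m'" by (metis iexp_add)
    then have "a i - a j = (iexp m - iexp n) - (iexp m' - iexp n)"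
      using b i j by (simp add: algebra_simps)
    also have "\<dots> \<in> H"
      using P(2)[OF j] P(2)[OF i(1)] m m' n by (intro diff_mem[of "iexp _ - iexp _"]) (auto simp: congruent_exps_def)
    finally show False using distinct[of i j] i j by simp
  qed
  then have "lookup (\<Sum>i\<in>I. mon (b i) * P i) (b j + m)
      = lookup (mon (b j) * P j) (b j + m)"
    unfolding lookup_sum using j \<open>finite I\<close>
    by (subst sum.remove[of _ j]) (auto intro!: sum.neutral simp: in_keys_iff)
  moreover have "b j + m \<in> keys (mon (b j) * P j)"
    using m by (auto simp: keys_mon_mult)
  ultimately show False using zero by (simp add: in_keys_iff)
qed

text \<open>
  A polynomial equation for \<open>x\<^sup>a\<close> is a linear relation between the Laurent monomials \<open>x\<^sup>i\<^sup>a\<close>, so two of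
  the exponents \<open>i a\<close> are congruent modulo \<open>H\<close>.
\<close>

lemma algebraic_laurent_monomial_multiple:
  assumes a: "keys a \<subseteq> {..<N}"
    and alg: "algebraic_over (coset_fractions N H) (laurent_monomial N a :: 'k::field ratf)"
  shows "\<exists>t>0. frag_cmul t a \<in> H"
proof -
  obtain p where p: "p \<noteq> 0" "\<And>i. coeff p i \<in> coset_fractions N H"
      "poly p (laurent_monomial N a :: 'k ratf) = 0"
    using alg by (auto simp: algebraic_over_def)
  have pow: "laurent_monomial N a ^ i = (laurent_monomial N (frag_cmul (int i) a) :: 'k ratf)" for i
    by (induction i) (simp_all add: frag_cmul_distrib laurent_monomial_add)
  have "\<exists>i\<in>{..degree p}. \<exists>j\<in>{..degree p}. i \<noteq> j \<and> frag_cmul (int i) a - frag_cmul (int j) a \<in> H"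
  proof (rule ccontr)
    assume "\<not> ?thesis"
    then have distinct: "frag_cmul (int i) a - frag_cmul (int j) a \<notin> H"
      if "i \<in> {..degree p}" "j \<in> {..degree p}" "i \<noteq> j" for i j
      using that by blast
    have sum0: "(\<Sum>i\<in>{..degree p}. coeff p i * laurent_monomial N (frag_cmul (int i) a)) = 0"
      using p(3) by (simp add: poly_altdef pow)
    have "coeff p (degree p) = 0"
    proof (rule laurent_monomials_independent_mod[where a = "\<lambda>i. frag_cmul (int i) a"])
      show "keys (frag_cmul (int i) a) \<subseteq> {..<N}" for i
        using keys_cmul[of "int i" a] a by blast
      show "degree p \<in> {..degree p}" "finite {..degree p}" by auto
      show "coeff p i \<in> coset_fractions N H" for i by (rule p(2))
      show "frag_cmul (int i) a - frag_cmul (int j) a \<notin> H"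
        if "i \<in> {..degree p}" "j \<in> {..degree p}" "i \<noteq> j" for i j
        using that by (rule distinct)
    qed (rule sum0)
    then show False using p(1) by simp
  qed
  then obtain i j where ij: "i \<noteq> j" "frag_cmul (int i) a - frag_cmul (int j) a \<in> H"
    by blast
  show ?thesis
  proof (cases "i > j")
    case True
    then show ?thesis using ij
      by (intro exI[of _ "int i - int j"]) (simp add: frag_cmul_diff_distrib)
  next
    case False
    then show ?thesis using ij uminus_mem[OF ij(2)]
      by (intro exI[of _ "int j - int i"]) (simp add: frag_cmul_diff_distrib)
  qed
qed

end

lemma field_adjoin_subset: "S \<subseteq> field_adjoin S"
  by (auto simp: field_adjoin_def)

lemma rconst_in_field_adjoin: "range rconst \<subseteq> field_adjoin S"
  by (auto simp: field_adjoin_def)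

lemma is_subfield_field_adjoin: "is_subfield (field_adjoin S)"
  by (auto simp: field_adjoin_def is_subfield_def)

lemma field_adjoin_least:
  "is_subfield K \<Longrightarrow> range rconst \<subseteq> K \<Longrightarrow> S \<subseteq> K \<Longrightarrow> field_adjoin S \<subseteq> K"
  by (auto simp: field_adjoin_def)

lemma algebraic_over_mono: "algebraic_over K y \<Longrightarrow> K \<subseteq> L \<Longrightarrow> algebraic_over L y"
  unfolding algebraic_over_def by blast

lemma exponent_group_group_closure:
  assumes "\<And>a. a \<in> A \<Longrightarrow> keys a \<subseteq> {..<N}"
  shows "exponent_group N (group_closure A)"
proof
  show "keys a \<subseteq> {..<N}" if "a \<in> group_closure A" for a
    using that
  proof induction
    case (base s)
    then show ?case using assms by auto
  next
    case (diff s t)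
    then show ?case using keys_diff[of s t] by blast
  qed
qed (auto intro: group_closure.diff)

lemma (in exponent_group) group_closure_subset: "A \<subseteq> H \<Longrightarrow> group_closure A \<subseteq> H"
proof
  fix a assume "A \<subseteq> H" "a \<in> group_closure A"
  from this(2,1) show "a \<in> H"
    by induction (auto simp: zero_mem diff_mem)
qed

lemma field_adjoin_laurent_monomials:
  assumes A: "\<And>a. a \<in> A \<Longrightarrow> keys a \<subseteq> {..<N}"
  shows "field_adjoin (laurent_monomial N ` A :: 'k::field ratf set) = coset_fractions N (group_closure A)"
proof
  interpret exponent_group N "group_closure A" using A by (rule exponent_group_group_closure)
  have "A \<subseteq> group_closure A" by (auto intro: group_closure.base)
  then show "field_adjoin (laurent_monomial N ` A :: 'k ratf set) \<subseteq> coset_fractions N (group_closure A)"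
    using A by (intro field_adjoin_least is_subfield_coset_fractions)
      (auto simp: rconst_mem laurent_monomial_mem_iff)
  let ?F = "field_adjoin (laurent_monomial N ` A :: 'k ratf set)"
  have "laurent_monomial N a \<in> ?F" if "a \<in> group_closure A" for a
    using that
  proof induction
    case (base s)
    then show ?case
      using field_adjoin_subset[of "laurent_monomial N ` A :: 'k ratf set"]
        is_subfield_field_adjoin[of "laurent_monomial N ` A :: 'k ratf set"]
      by (auto simp: is_subfield_def)
  next
    case (diff s t)
    then show ?case by (simp add: laurent_monomial_diff is_subfield_divide is_subfield_field_adjoin)
  qed
  then show "coset_fractions N (group_closure A) \<subseteq> ?F"
    by (intro coset_fractions_subset_subfield is_subfield_field_adjoin rconst_in_field_adjoin) auto
qed

section \<open>Algebraic dependence of Laurent monomials\<close>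

interpretation frag_module: module "frag_cmul :: int \<Rightarrow> ('a \<Rightarrow>\<^sub>0 int) \<Rightarrow> _"
  by unfold_locales (simp_all add: frag_cmul_distrib frag_cmul_distrib2)

text \<open>
  A product of powers of the given Laurent monomials is again a Laurent monomial. Linear
  independence of the exponents makes distinct products distinct, and distinct Laurent monomials
  are linearly independent over the constants: this is \<open>laurent_monomials_independent_mod\<close> for the
  trivial group.
\<close>

lemma alg_independent_laurent_monomials:
  assumes B: "\<And>b. b \<in> B \<Longrightarrow> keys b \<subseteq> {..<N}"
    and indep: "\<not> module.dependent frag_cmul B"
  shows "alg_independent (laurent_monomial N ` B :: 'k::field ratf set)"
  unfolding alg_independent_def
proof (intro allI impI, elim conjE)
  fix P :: "('k ratf \<Rightarrow>\<^sub>0 nat) \<Rightarrow>\<^sub>0 'k"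
  assume keys: "\<forall>m\<in>keys P. keys m \<subseteq> laurent_monomial N ` B"
  assume sum0: "(\<Sum>m\<in>keys P. rconst (lookup P m) *
           (\<Prod>y\<in>keys m. y ^ lookup m y)) = 0"
  \<comment> \<open>The variables of \<open>P\<close> are the Laurent monomials themselves; \<open>\<beta>\<close> returns their exponents.\<close>
  define \<beta> where "\<beta> = inv_into B (laurent_monomial N :: _ \<Rightarrow> 'k ratf)"
  have \<beta>: "\<beta> y \<in> B" "laurent_monomial N (\<beta> y) = y" if "y \<in> laurent_monomial N ` B" for y
    using that by (auto simp: \<beta>_def inv_into_into f_inv_into_f)
  define a where "a m = (\<Sum>y\<in>keys m. frag_cmul (int (lookup m y)) (\<beta> y))" for m
  have pow: "laurent_monomial N c ^ i = (laurent_monomial N (frag_cmul (int i) c) :: 'k ratf)"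
    for i c
    by (induction i) (simp_all add: frag_cmul_distrib laurent_monomial_add)
  have prod: "(\<Prod>y\<in>keys m. y ^ lookup m y) = laurent_monomial N (a m)"
    if "m \<in> keys P" for m
    unfolding a_def laurent_monomial_sum pow[symmetric]
    using keys that \<beta>(2) by (intro prod.cong) (auto simp: subset_iff)
  have aN: "keys (a m) \<subseteq> {..<N}" if m: "m \<in> keys P" for m
  proof -
    have "keys (\<beta> y) \<subseteq> {..<N}" if "y \<in> keys m" for y
      using keys m that B \<beta>(1) by blast
    then show ?thesis
      unfolding a_def using keys_sum[of "\<lambda>y. frag_cmul (int (lookup m y)) (\<beta> y)" "keys m"]
      by fastforce
  qed
  have inj: "m = m'" if m: "m \<in> keys P" "m' \<in> keys P" and eq: "a m = a m'" for m m'
  proof (rule poly_mapping_eqI)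
    fix y
    let ?Y = "keys m \<union> keys m'"
    define u where "u b = int (lookup m (laurent_monomial N b)) - int (lookup m' (laurent_monomial N b))" for b
    have Y: "?Y \<subseteq> laurent_monomial N ` B" using keys m by blast
    have ext: "a n = (\<Sum>y\<in>?Y. frag_cmul (int (lookup n y)) (\<beta> y))" if "n = m \<or> n = m'" for n
      unfolding a_def using that by (intro sum.mono_neutral_left) (auto simp: in_keys_iff)
    have "inj_on \<beta> ?Y" using Y \<beta>(2) by (metis inj_on_inverseI subsetD)
    then have "(\<Sum>b\<in>\<beta> ` ?Y. frag_cmul (u b) b) = (\<Sum>y\<in>?Y. frag_cmul (u (\<beta> y)) (\<beta> y))"
      by (simp add: sum.reindex)
    also have "\<dots> = a m - a m'"
      unfolding ext[OF disjI1[OF refl]] ext[OF disjI2[OF refl]] sum_subtractf[symmetric]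
      using Y by (intro sum.cong refl) (auto simp: u_def frag_cmul_diff_distrib \<beta>(2) subset_iff)
    finally have z: "(\<Sum>b\<in>\<beta> ` ?Y. frag_cmul (u b) b) = 0" using eq by simp
    have "\<beta> ` ?Y \<subseteq> B" using Y \<beta>(1) by blast
    from frag_module.independentD[OF indep _ this z] have "u (\<beta> y) = 0" if "y \<in> ?Y" for y
      using that by auto
    then show "lookup m y = lookup m' y"
    proof (cases "y \<in> ?Y")
      case True
      then have "u (\<beta> y) = 0" "laurent_monomial N (\<beta> y) = y"
        using \<open>\<And>y. y \<in> ?Y \<Longrightarrow> u (\<beta> y) = 0\<close> Y \<beta>(2) by auto
      then show ?thesis by (simp add: u_def)
    next
      case False
      then show ?thesis by (auto simp: in_keys_iff)
    qed
  qed
  interpret trivial: exponent_group N "{0}" by unfold_locales auto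
  have "rconst (lookup P m) = 0" if "m \<in> keys P" for m
  proof (rule trivial.laurent_monomials_independent_mod[where a = a])
    show "(\<Sum>m\<in>keys P. rconst (lookup P m) * laurent_monomial N (a m)) = 0"
      using sum0 by (simp add: prod cong: sum.cong)
    show "m \<in> keys P" by fact
  qed (use inj in \<open>auto simp: trivial.rconst_mem aN simp del: keys_eq_empty\<close>)
  then have "lookup P m = 0" if "m \<in> keys P" for m
    using that by (auto simp: rconst_def mconst_def simp flip: to_fract_def)
       (metis lookup_single_eq lookup_zero)
  then show "P = 0" by (metis in_keys_iff keys_eq_empty ex_in_conv)
qed

lemma finite_bounded_exponents:
  "finite {m :: nat \<Rightarrow>\<^sub>0 nat. keys m \<subseteq> {..<N} \<and> (\<forall>i<N. lookup m i < t i)}"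
    (is "finite ?D")
proof (rule finite_imageD)
  show "finite ((\<lambda>m. restrict (lookup m) {..<N}) ` ?D)"
    by (rule finite_subset[OF _ finite_PiE[of "{..<N}" "\<lambda>i. {..<t i}"]])
       (auto split: if_splits)
  show "inj_on (\<lambda>m. restrict (lookup m) {..<N}) ?D"
  proof (rule inj_onI, rule poly_mapping_eqI)
    fix m n i
    assume "m \<in> ?D" "n \<in> ?D"
      and eq: "restrict (lookup m) {..<N} = restrict (lookup n) {..<N}"
    then have "i \<notin> keys m" "i \<notin> keys n" if "\<not> i < N" using that by auto
    moreover have "lookup m i = lookup n i" if "i < N"
      using fun_cong[OF eq, of i] that by simp
    ultimately show "lookup m i = lookup n i"
      by (cases "i < N") (simp_all add: in_keys_iff)
  qed
qed

text \<open>
  Let \<open>t i\<close> be multiples of the unit vectors that bring them into \<open>H\<close>. Reducing exponents modulo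
  \<open>t\<close> shows that over the field of \<open>H\<close> all polynomials lie in the span of the finite set \<open>D\<close> of
  monomials with exponents below \<open>t\<close>. For \<open>y = p/q\<close> and \<open>n = card D\<close>, the \<open>n + 1\<close> polynomials
  \<open>p\<^sup>i q\<^sup>n\<^sup>-\<^sup>i\<close> are therefore linearly dependent, and division by \<open>q\<^sup>n\<close> gives an equation for \<open>y\<close>.
\<close>

lemma (in exponent_group) ratfuns_algebraic:
  assumes t: "\<And>i. i < N \<Longrightarrow> \<exists>k>0. frag_cmul k (frag_of i) \<in> H"
    and y: "y \<in> ratfuns N"
  shows "algebraic_over (coset_fractions N H) (y :: 'k::field ratf)"
proof -
  let ?K = "coset_fractions N H :: 'k ratf set"
  have "\<exists>k::nat. k > 0 \<and> frag_cmul (int k) (frag_of i) \<in> H" if "i < N" for i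
    using t[OF that] by (metis nat_0_le zero_less_nat_eq less_imp_le)
  then obtain t :: "nat \<Rightarrow> nat" where t: "\<And>i. i < N \<Longrightarrow> t i > 0 \<and> frag_cmul (int (t i)) (frag_of i) \<in> H"
    by metis
  define D where "D = {m :: nat \<Rightarrow>\<^sub>0 nat. keys m \<subseteq> {..<N} \<and> (\<forall>i<N. lookup m i < t i)}"
  have finD: "finite D" unfolding D_def by (rule finite_bounded_exponents)
  define \<pi> where "\<pi> m = (\<Sum>i<N. Poly_Mapping.single i (lookup m i mod t i))" for m :: "nat \<Rightarrow>\<^sub>0 nat"
  have lookup_\<pi>: "lookup (\<pi> m) i = (if i < N then lookup m i mod t i else 0)" for m i
    by (simp add: \<pi>_def lookup_sum lookup_single when_def)
  have \<pi>D: "\<pi> m \<in> D" for m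
    using t by (auto simp: D_def lookup_\<pi> in_keys_iff split: if_splits)
  have \<pi>H: "iexp m - iexp (\<pi> m) \<in> H" if "keys m \<subseteq> {..<N}" for m
  proof -
    have "iexp m - iexp (\<pi> m) =
        (\<Sum>i<N. frag_cmul (int (lookup m i div t i)) (frag_cmul (int (t i)) (frag_of i)))"
    proof (rule poly_mapping_eqI)
      fix k
      have "lookup m k = 0" if "\<not> k < N"
        using that \<open>keys m \<subseteq> {..<N}\<close> by (auto simp: in_keys_iff)
      moreover have "int x - int (x mod s) = int (x div s) * int s" for x s :: nat
        by (metis add_diff_cancel_right' div_mult_mod_eq of_nat_add of_nat_mult)
      ultimately show "lookup (iexp m - iexp (\<pi> m)) k = lookup
          (\<Sum>i<N. frag_cmul (int (lookup m i div t i)) (frag_cmul (int (t i)) (frag_of i))) k"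
        by (simp add: lookup_minus lookup_sum lookup_\<pi> if_distrib cong: if_cong)
    qed
    then show ?thesis using t by (simp only:) (rule sum_mem, rule frag_cmul_mem, simp)
  qed
  note K = is_subfield_coset_fractions[where 'k = 'k]
  have expand: "\<exists>c. (\<forall>r\<in>D. c r \<in> ?K) \<and> to_fract p = (\<Sum>r\<in>D. c r * to_fract (mon r))"
    if p: "p \<in> polys N" for p
  proof (intro exI conjI ballI)
    let ?c = "\<lambda>r. \<Sum>m\<in>{m \<in> keys p. \<pi> m = r}.
        rconst (lookup p m) * laurent_monomial N (iexp m - iexp (\<pi> m))"
    show "?c r \<in> ?K" for r
    proof (intro is_subfield_sum[OF K] is_subfield_mult[OF K] rconst_mem)
      fix m assume "m \<in> {m \<in> keys p. \<pi> m = r}"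
      then have "keys m \<subseteq> {..<N}" using p polys_keys by auto
      then show "laurent_monomial N (iexp m - iexp (\<pi> m)) \<in> ?K"
        using \<pi>H[of m] supported by (subst laurent_monomial_mem_iff) auto
    qed
    have "to_fract p = (\<Sum>m\<in>keys p. rconst (lookup p m) * to_fract (mon m))"
      by (rule to_fract_eq_sum)
    also have "\<dots> = (\<Sum>m\<in>keys p. rconst (lookup p m) *
        laurent_monomial N (iexp m - iexp (\<pi> m)) * to_fract (mon (\<pi> m)))"
      using \<pi>D polys_keys[OF p]
      by (intro sum.cong) (auto simp: to_fract_mon[of _ N] laurent_monomial_diff D_def)
    also have "\<dots> = (\<Sum>r\<in>D. \<Sum>m\<in>{m \<in> keys p. \<pi> m = r}. rconst (lookup p m) *
        laurent_monomial N (iexp m - iexp (\<pi> m)) * to_fract (mon (\<pi> m)))"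
      using \<pi>D finD by (intro sum.group[symmetric]) auto
    also have "\<dots> = (\<Sum>r\<in>D. ?c r * to_fract (mon r))"
      by (intro sum.cong refl) (auto simp: sum_distrib_right intro!: sum.cong)
    finally show "to_fract p = (\<Sum>r\<in>D. ?c r * to_fract (mon r))" .
  qed
  obtain p q where pq: "p \<in> polys N" "q \<in> polys N" "q \<noteq> 0" "y = Fract p q"
    using y by (auto simp: ratfuns_def)
  define n where "n = card D"
  have "\<exists>c. (\<forall>r\<in>D. c r \<in> ?K) \<and> to_fract (p ^ i * q ^ (n - i)) = (\<Sum>r\<in>D. c r * to_fract (mon r))"
    for i
    using pq by (intro expand polys_mult polys_power)
  then obtain c where c: "\<And>i r. r \<in> D \<Longrightarrow> c i r \<in> ?K"
      "\<And>i. to_fract (p ^ i * q ^ (n - i)) = (\<Sum>r\<in>D. c i r * to_fract (mon r))"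
    using choice[of "\<lambda>i c. (\<forall>r\<in>D. c r \<in> ?K) \<and>
        to_fract (p ^ i * q ^ (n - i)) = (\<Sum>r\<in>D. c r * to_fract (mon r))"]
    by blast
  obtain u where u: "\<forall>i\<in>{..n}. u i \<in> ?K" "\<exists>i\<in>{..n}. u i \<noteq> 0" "\<forall>r\<in>D. (\<Sum>i\<in>{..n}. u i * c i r) = 0"
    using homogeneous_system_nontrivial_solution[OF K finD, of "{..n}" c] c(1) by (auto simp: n_def)
  define P where "P = (\<Sum>i\<in>{..n}. Polynomial.monom (u i) i)"
  have coeff_P: "coeff P i = (if i \<le> n then u i else 0)" for i
    by (simp add: P_def coeff_sum)
  have "poly P y * to_fract q ^ n = (\<Sum>i\<in>{..n}. u i * to_fract (p ^ i * q ^ (n - i)))"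
    unfolding P_def poly_sum sum_distrib_right
  proof (intro sum.cong refl)
    fix i assume "i \<in> {..n}"
    then have "to_fract q ^ n = to_fract q ^ i * to_fract q ^ (n - i)" by (simp flip: power_add)
    then show "poly (Polynomial.monom (u i) i) y * to_fract q ^ n = u i * to_fract (p ^ i * q ^ (n - i))"
      using pq by (simp add: poly_monom Fract_conv_to_fract power_divide to_fract_power)
  qed
  also have "\<dots> = (\<Sum>i\<in>{..n}. \<Sum>r\<in>D. u i * c i r * to_fract (mon r))"
    by (simp only: c(2) sum_distrib_left mult.assoc)
  also have "\<dots> = (\<Sum>r\<in>D. (\<Sum>i\<in>{..n}. u i * c i r) * to_fract (mon r))"
    by (subst sum.swap) (simp add: sum_distrib_right)
  also have "\<dots> = 0" using u(3) by simp
  finally have "poly P y = 0" using pq(3) by simp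
  moreover have "P \<noteq> 0" using u(2) coeff_P by (metis coeff_0 atMost_iff)
  moreover have "coeff P i \<in> ?K" for i using u(1) K by (auto simp: coeff_P is_subfield_def)
  ultimately show ?thesis by (auto simp: algebraic_over_def)
qed

section \<open>Degrees of rational functions\<close>

definition mdeg :: "(nat \<Rightarrow>\<^sub>0 nat) \<Rightarrow> nat" where
  "mdeg m = (\<Sum>i\<in>keys m. lookup m i)"

lemma mdeg_eq_sum: "finite S \<Longrightarrow> keys m \<subseteq> S \<Longrightarrow> mdeg m = (\<Sum>i\<in>S. lookup m i)"
  unfolding mdeg_def by (rule sum.mono_neutral_left) (auto simp: in_keys_iff)

lemma mdeg_add: "mdeg (m + n) = mdeg m + mdeg n"
proof -
  let ?S = "keys m \<union> keys n"
  have "keys (m + n) \<subseteq> ?S" by (rule keys_add)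
  then show ?thesis
    by (simp add: mdeg_eq_sum[of ?S] lookup_add sum.distrib)
qed

lemma mdeg_eq_0_iff: "mdeg m = 0 \<longleftrightarrow> m = 0"
proof
  assume "mdeg m = 0"
  then have "\<forall>i\<in>keys m. lookup m i = 0" by (simp add: mdeg_def)
  then have "lookup m i = 0" for i by (cases "i \<in> keys m") (auto simp: in_keys_iff)
  then show "m = 0" by (intro poly_mapping_eqI) simp
qed (simp add: mdeg_def)

lemma total_degree_eq: "total_degree p = Max (insert 0 (mdeg ` keys p))"
  by (simp add: total_degree_def mdeg_def)

lemma mdeg_le_total_degree: "m \<in> keys p \<Longrightarrow> mdeg m \<le> total_degree p"
  by (simp add: total_degree_eq)

lemma total_degree_le: "(\<And>m. m \<in> keys p \<Longrightarrow> mdeg m \<le> d) \<Longrightarrow> total_degree p \<le> d"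
  by (simp add: total_degree_eq)

lemma total_degree_attained:
  assumes "p \<noteq> 0"
  shows "\<exists>m\<in>keys p. mdeg m = total_degree p"
proof -
  obtain n where n: "n \<in> keys p" using assms by (metis keys_eq_empty all_not_in_conv)
  have "total_degree p \<in> insert 0 (mdeg ` keys p)"
    unfolding total_degree_eq by (rule Max_in) auto
  then show ?thesis using n mdeg_le_total_degree[OF n] by auto
qed

lemma total_degree_mon: "total_degree (mon m :: 'k::field mpol) = mdeg m"
  by (simp add: total_degree_eq)

text \<open>
  Serves for two decompositions: the homogeneous part of top degree, and the isotypic component
  of a character.
\<close>

definition monomial_part :: "(nat \<Rightarrow>\<^sub>0 nat) set \<Rightarrow> 'k::field mpol \<Rightarrow> 'k mpol" where
  "monomial_part M = Poly_Mapping.mapp (\<lambda>m c. c when m \<in> M)"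

lemma lookup_monomial_part: "lookup (monomial_part M p) m = (lookup p m when m \<in> M)"
  by (simp add: monomial_part_def lookup_mapp when_def in_keys_iff)

lemma keys_monomial_part: "keys (monomial_part M p) = keys p \<inter> M"
  by (auto simp: in_keys_iff lookup_monomial_part)

lemma monomial_part_decomp: "p = monomial_part M p + monomial_part (- M) p"
  by (rule poly_mapping_eqI) (simp add: lookup_add lookup_monomial_part when_def)

lemma monomial_part_in_polys: "p \<in> polys N \<Longrightarrow> monomial_part M p \<in> polys N"
  by (auto simp: polys_def keys_monomial_part)

text \<open>
  The product of the top homogeneous parts is nonzero, and none of its monomials can be cancelled,
  since all other products of monomials have smaller degree.
\<close>

lemma total_degree_mult:
  fixes p q :: "'k::field mpol"
  assumes "p \<noteq> 0" "q \<noteq> 0"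
  shows "total_degree (p * q) = total_degree p + total_degree q"
proof (rule antisym)
  show "total_degree (p * q) \<le> total_degree p + total_degree q"
  proof (rule total_degree_le)
    fix m assume "m \<in> keys (p * q)"
    then obtain a b where "a \<in> keys p" "b \<in> keys q" "m = a + b"
      using keys_mult[of p q] by auto
    then show "mdeg m \<le> total_degree p + total_degree q"
      using mdeg_le_total_degree[of a p] mdeg_le_total_degree[of b q] by (simp add: mdeg_add)
  qed
  define P where "P = {m. mdeg m = total_degree p}"
  define Q where "Q = {m. mdeg m = total_degree q}"
  have "keys (monomial_part P p) \<noteq> {}" "keys (monomial_part Q q) \<noteq> {}"
    using total_degree_attained[OF assms(1)] total_degree_attained[OF assms(2)]
    by (auto simp: keys_monomial_part P_def Q_def simp del: keys_eq_empty)
  then have "monomial_part P p * monomial_part Q q \<noteq> 0" by simp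
  then obtain k where k: "k \<in> keys (monomial_part P p * monomial_part Q q)"
    by (metis keys_eq_empty all_not_in_conv)
  then obtain a b where "a \<in> keys (monomial_part P p)" "b \<in> keys (monomial_part Q q)" "k = a + b"
    using keys_mult[of "monomial_part P p" "monomial_part Q q"] by auto
  then have deg_k: "mdeg k = total_degree p + total_degree q"
    by (simp add: keys_monomial_part P_def Q_def mdeg_add)
  have split: "p * q = monomial_part P p * monomial_part Q q +
      (monomial_part P p * monomial_part (- Q) q + monomial_part (- P) p * q)"
  proof -
    have "p * q = monomial_part P p * q + monomial_part (- P) p * q"
      by (metis monomial_part_decomp distrib_right)
    moreover have "monomial_part P p * q =
        monomial_part P p * monomial_part Q q + monomial_part P p * monomial_part (- Q) q"
      by (metis monomial_part_decomp distrib_left)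
    ultimately show ?thesis by simp
  qed
  have "k \<notin> keys (monomial_part P p * monomial_part (- Q) q)"
  proof
    assume "k \<in> keys (monomial_part P p * monomial_part (- Q) q)"
    then obtain a b where ab: "a \<in> keys (monomial_part P p)" "b \<in> keys (monomial_part (- Q) q)"
        "k = a + b"
      using keys_mult[of "monomial_part P p" "monomial_part (- Q) q"] by auto
    then show False using deg_k by (auto simp: keys_monomial_part P_def Q_def mdeg_add)
  qed
  moreover have "k \<notin> keys (monomial_part (- P) p * q)"
  proof
    assume "k \<in> keys (monomial_part (- P) p * q)"
    then obtain a b where ab: "a \<in> keys (monomial_part (- P) p)" "b \<in> keys q" "k = a + b"
      using keys_mult[of "monomial_part (- P) p" q] by auto
    then have "mdeg a < total_degree p"
      using mdeg_le_total_degree[of a p] by (auto simp: keys_monomial_part P_def)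
    moreover have "mdeg b \<le> total_degree q" using ab by (simp add: mdeg_le_total_degree)
    ultimately show False using deg_k ab by (simp add: mdeg_add)
  qed
  ultimately have "k \<in> keys (p * q)"
    using k by (subst split) (simp add: in_keys_iff lookup_add)
  then show "total_degree p + total_degree q \<le> total_degree (p * q)"
    using mdeg_le_total_degree deg_k by metis
qed

lemma total_degree_0_unit:
  fixes r :: "'k::field mpol"
  assumes "r \<noteq> 0" "total_degree r = 0"
  shows "\<exists>s\<in>polys N. r * s = 1"
proof -
  have "m = 0" if "m \<in> keys r" for m
    using mdeg_le_total_degree[OF that] assms(2) by (simp add: mdeg_eq_0_iff)
  then have "keys r \<subseteq> {0}" by auto
  then have r: "r = Poly_Mapping.single 0 (lookup r 0)"
    by (intro poly_mapping_eqI) (auto simp: lookup_single when_def in_keys_iff)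
  then have "lookup r 0 \<noteq> 0" using assms(1) by (metis single_zero)
  then have "r * Poly_Mapping.single 0 (inverse (lookup r 0)) = 1"
    by (subst r) (simp add: mult_single)
  then show ?thesis by (intro bexI[of _ "Poly_Mapping.single 0 (inverse (lookup r 0))"])
    (auto simp: single_in_polys)
qed

text \<open>
  Cancelling a common factor that is not a unit lowers the degree of the denominator, because
  polynomials of degree \<open>0\<close> are units.
\<close>

lemma reduced_fraction_exists:
  fixes p q :: "'k::field mpol"
  assumes "p \<in> polys N" "q \<in> polys N" "q \<noteq> 0"
  shows "\<exists>p'\<in>polys N. \<exists>q'\<in>polys N. q' \<noteq> 0 \<and> Fract p q = Fract p' q' \<and> coprime_polys N p' q'"
  using assms
proof (induction "total_degree q" arbitrary: p q rule: less_induct)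
  case less
  show ?case
  proof (cases "coprime_polys N p q")
    case True
    then show ?thesis using less.prems by blast
  next
    case False
    then obtain r s t where r: "r \<in> polys N" "s \<in> polys N" "p = r * s" "t \<in> polys N" "q = r * t"
        and nu: "\<not> (\<exists>s\<in>polys N. r * s = 1)"
      by (auto simp: coprime_polys_def)
    have nz: "r \<noteq> 0" "t \<noteq> 0" using r less.prems by auto
    then have "total_degree r \<noteq> 0" using nu total_degree_0_unit by blast
    then have "total_degree t < total_degree q" using r nz by (simp add: total_degree_mult)
    from less.hyps[OF this r(2,4) nz(2)] show ?thesis
      using r nz by (simp add: mult_fract_cancel)
  qed
qed

lemma ratfun_degree_witness:
  fixes f :: "'k::field ratf"
  assumes "f \<in> ratfuns N"
  shows "\<exists>p\<in>polys N. \<exists>q\<in>polys N. q \<noteq> 0 \<and> f = Fract p q \<and> coprime_polys N p q \<and>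
           ratfun_degree N f = total_degree p + total_degree q"
proof -
  have "\<exists>d. \<exists>p\<in>polys N. \<exists>q\<in>polys N. q \<noteq> 0 \<and> f = Fract p q \<and> coprime_polys N p q \<and>
           d = total_degree p + total_degree q"
  proof -
    obtain p q where "f = Fract p q" "p \<in> polys N" "q \<in> polys N" "q \<noteq> 0"
      using assms by (auto simp: ratfuns_def)
    then show ?thesis using reduced_fraction_exists[of p N q] by blast
  qed
  then show ?thesis unfolding ratfun_degree_def by (rule someI_ex)
qed

text \<open>
  The selected representation \<open>p/q\<close> is only known to be coprime, so it has to be compared with
  \<open>x\<^sup>u/x\<^sup>v\<close>, where \<open>u\<close> and \<open>v\<close> are the positive and negative parts of \<open>a\<close>. Since \<open>u\<close> and \<open>v\<close> have
  disjoint supports, \<open>x\<^sup>v p = x\<^sup>u q\<close> forces \<open>x\<^sup>u\<close> to divide \<open>p\<close> monomial by monomial; the quotient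
  divides \<open>q\<close> as well, hence is a constant.
\<close>

lemma ratfun_degree_laurent_monomial:
  assumes a: "keys a \<subseteq> {..<N}"
  shows "int (ratfun_degree N (laurent_monomial N a :: 'k::field ratf)) = (\<Sum>i<N. \<bar>lookup a i\<bar>)"
proof -
  define u v where "u = pos_exp a" and "v = pos_exp (- a)"
  have uv: "keys u \<subseteq> {..<N}" "keys v \<subseteq> {..<N}"
    using a keys_pos_exp[of a] keys_pos_exp[of "- a"] by (auto simp: u_def v_def)
  note L = laurent_monomial_eq_Fract[OF a, where 'k = 'k, folded u_def v_def]
  have "(laurent_monomial N a :: 'k ratf) \<in> ratfuns N"
    unfolding L ratfuns_def using uv single_in_polys mon_nonzero by blast
  then obtain p q :: "'k mpol" where pq: "p \<in> polys N" "q \<in> polys N" "q \<noteq> 0"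
      "laurent_monomial N a = Fract p q" "coprime_polys N p q"
    and deg: "ratfun_degree N (laurent_monomial N a :: 'k ratf) = total_degree p + total_degree q"
    using ratfun_degree_witness by blast
  have eq: "mon v * p = mon u * q" using pq(3,4) by (simp add: L eq_fract mult.commute)
  have div: "u + (k - u) = k" if "k \<in> keys p" for k
  proof (rule poly_mapping_eqI)
    fix i
    have "v + k \<in> keys (mon u * q)" using that by (simp add: eq[symmetric] keys_mon_mult)
    then obtain n where "v + k = u + n" by (auto simp: keys_mon_mult)
    then have "lookup v i + lookup k i = lookup u i + lookup n i"
      by (metis lookup_add)
    moreover have "lookup u i = 0 \<or> lookup v i = 0"
      by (auto simp: u_def v_def)
    ultimately show "lookup (u + (k - u)) i = lookup k i"
      by (auto simp: lookup_add lookup_minus)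
  qed
  define s where "s = (\<Sum>k\<in>keys p. Poly_Mapping.single (k - u) (lookup p k))"
  have ps: "p = mon u * s"
    unfolding s_def sum_distrib_left
    by (subst poly_eq_sum_single) (auto simp: mult_single div intro!: sum.cong)
  have "s \<in> polys N" unfolding s_def
  proof (intro polys_sum single_in_polys)
    fix k assume "k \<in> keys p"
    then have "keys k \<subseteq> {..<N}" using pq(1) polys_keys by blast
    then show "keys (k - u) \<subseteq> {..<N}" by (auto simp: in_keys_iff lookup_minus subset_iff)
  qed
  have "mon u * (mon v * s) = mon u * q" using eq by (simp add: ps ac_simps)
  then have qs: "q = mon v * s" by (metis mon_nonzero mult_left_cancel)
  have "\<exists>w\<in>polys N. s * w = 1"
  proof -
    have "p = s * mon u" "q = s * mon v" using ps qs by (simp_all add: mult.commute)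
    moreover have "mon u \<in> (polys N :: 'k mpol set)" "mon v \<in> (polys N :: 'k mpol set)"
      using uv by (auto intro: single_in_polys)
    ultimately show ?thesis using pq(5) \<open>s \<in> polys N\<close> unfolding coprime_polys_def by blast
  qed
  then obtain w where w: "s * w = 1" by blast
  then have "s \<noteq> 0" "w \<noteq> 0" by auto
  then have "total_degree s + total_degree w = 0"
    using total_degree_mult[of s w] total_degree_mon[of 0, where 'k = 'k] w by (simp add: mdeg_def)
  then have "total_degree p + total_degree q = mdeg u + mdeg v"
    using \<open>s \<noteq> 0\<close> by (simp add: ps qs total_degree_mult total_degree_mon)
  also have "int (\<dots>) = (\<Sum>i<N. \<bar>lookup a i\<bar>)"
    using uv by (simp add: mdeg_eq_sum[of "{..<N}"] u_def v_def flip: sum.distrib) (auto intro: sum.cong)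
  finally show ?thesis using deg by simp
qed

section \<open>Sublattices of full rank\<close>

lemma clear_denominators:
  fixes u :: "'i \<Rightarrow> rat"
  assumes "finite B"
  shows "\<exists>d z. d \<noteq> (0::int) \<and> (\<forall>b\<in>B. of_int d * u b = of_int (z b))"
  using assms
proof (induction B rule: finite_induct)
  case empty
  show ?case by (intro exI[of _ 1]) auto
next
  case (insert a B)
  then obtain d z where dz: "d \<noteq> (0::int)" "\<And>b. b \<in> B \<Longrightarrow> of_int d * u b = of_int (z b)" by blast
  obtain x y where xy: "u a = of_int x / of_int y" "y \<noteq> 0"
    using quotient_of_div[of "u a"] quotient_of_denom_pos[of "u a"] by (cases "quotient_of (u a)") force
  show ?case
  proof (intro exI[of _ "d * y"] exI[of _ "\<lambda>b. if b = a then d * x else z b * y"] conjI ballI)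
    show "d * y \<noteq> 0" using dz xy by simp
    fix b assume b: "b \<in> insert a B"
    show "of_int (d * y) * u b = of_int (if b = a then d * x else z b * y)"
    proof (cases "b = a")
      case True
      then show ?thesis using xy by simp
    next
      case False
      then have "of_int d * u b = of_int (z b)" using b dz by blast
      then show ?thesis using False by (simp add: algebra_simps)
    qed
  qed
qed

text \<open>
  More than \<open>N\<close> vectors are dependent over the rational numbers; clearing denominators makes the
  coefficients integers.
\<close>

lemma dependent_if_card_gt:
  assumes "finite B" and B: "\<And>b. b \<in> B \<Longrightarrow> keys b \<subseteq> {..<N}" and "N < card B"
  shows "module.dependent frag_cmul B"
proof -
  have "\<exists>u. (\<forall>b\<in>B. u b \<in> UNIV) \<and> (\<exists>b\<in>B. u b \<noteq> 0) \<and>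
      (\<forall>i\<in>{..<N}. (\<Sum>b\<in>B. u b * (of_int (lookup b i) :: rat)) = 0)"
    using assms by (intro homogeneous_system_nontrivial_solution) (auto simp: is_subfield_def)
  then obtain u :: "_ \<Rightarrow> rat" where u: "\<exists>b\<in>B. u b \<noteq> 0"
      "\<And>i. i < N \<Longrightarrow> (\<Sum>b\<in>B. u b * of_int (lookup b i)) = 0"
    by auto
  obtain d z where dz: "d \<noteq> 0" "\<And>b. b \<in> B \<Longrightarrow> of_int d * u b = of_int (z b)"
    using clear_denominators[OF assms(1), of u] by blast
  have "(\<Sum>b\<in>B. frag_cmul (z b) b) = 0"
  proof (rule poly_mapping_eqI)
    fix i
    show "lookup (\<Sum>b\<in>B. frag_cmul (z b) b) i = lookup 0 i"
    proof (cases "i < N")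
      case True
      have "rat_of_int (\<Sum>b\<in>B. z b * lookup b i)
          = of_int d * (\<Sum>b\<in>B. u b * of_int (lookup b i))"
        by (simp add: sum_distrib_left dz(2)[symmetric] mult.assoc)
      then have "rat_of_int (\<Sum>b\<in>B. z b * lookup b i) = 0" using u(2)[OF True] by simp
      then have "(\<Sum>b\<in>B. z b * lookup b i) = 0" by (simp only: of_int_eq_0_iff)
      then show ?thesis by (simp add: lookup_sum)
    next
      case False
      then have "lookup b i = 0" if "b \<in> B" for b
        using B[OF that] by (auto simp: in_keys_iff)
      then show ?thesis by (simp add: lookup_sum)
    qed
  qed
  moreover have "\<exists>b\<in>B. z b \<noteq> 0"
  proof -
    obtain b where "b \<in> B" "u b \<noteq> 0" using u by blast
    then have "rat_of_int (z b) \<noteq> 0" using dz by (metis mult_eq_0_iff of_int_eq_0_iff)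
    then show ?thesis using \<open>b \<in> B\<close> by auto
  qed
  ultimately show ?thesis
    using assms(1) by (auto simp: frag_module.dependent_explicit)
qed

text \<open>
  In a dependence of \<open>insert v C\<close> the coefficient of \<open>v\<close> cannot vanish; up to sign it is the
  required multiple.
\<close>

lemma multiple_in_group_closure:
  assumes indep: "\<not> module.dependent frag_cmul C" and dep: "module.dependent frag_cmul (insert v C)"
  shows "\<exists>k>0. frag_cmul k v \<in> group_closure C"
proof -
  obtain T u where T: "finite T" "T \<subseteq> insert v C" "(\<Sum>w\<in>T. frag_cmul (u w) w) = 0" "\<exists>w\<in>T. u w \<noteq> 0"
    using dep by (auto simp: frag_module.dependent_explicit)
  have mem: "frag_cmul k w \<in> group_closure C" if "w \<in> C" for k w
    by (rule frag_closure_minus_cmul) (auto intro: group_closure.intros that)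
  have sum: "(\<Sum>w\<in>T'. frag_cmul (u w) w) \<in> group_closure C" if "T' \<subseteq> C" for T'
    using that by (induction T' rule: infinite_finite_induct) (auto intro: group_closure_add mem)
  have v: "v \<in> T" "u v \<noteq> 0"
  proof -
    have "v \<in> T \<and> u v \<noteq> 0"
    proof (rule ccontr)
      assume *: "\<not> (v \<in> T \<and> u v \<noteq> 0)"
      have "(\<Sum>w\<in>T - {v}. frag_cmul (u w) w) = (\<Sum>w\<in>T. frag_cmul (u w) w)"
        using T(1) * by (intro sum.mono_neutral_left) auto
      then have "(\<Sum>w\<in>T - {v}. frag_cmul (u w) w) = 0" using T(3) by simp
      from frag_module.independentD[OF indep _ _ this] have "u w = 0" if "w \<in> T - {v}" for w
        using T that by auto
      then show False using T(4) * by blast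
    qed
    then show "v \<in> T" "u v \<noteq> 0" by auto
  qed
  have "frag_cmul (u v) v + (\<Sum>w\<in>T - {v}. frag_cmul (u w) w) = 0"
    using T v by (simp add: sum.remove)
  then have "frag_cmul (u v) v = - (\<Sum>w\<in>T - {v}. frag_cmul (u w) w)" by (simp add: add_eq_0_iff2)
  moreover have "(\<Sum>w\<in>T - {v}. frag_cmul (u w) w) \<in> group_closure C"
    using T(2) by (intro sum) auto
  ultimately have pos: "frag_cmul (u v) v \<in> group_closure C" by simp
  then have neg: "frag_cmul (- u v) v \<in> group_closure C"
    unfolding minus_frag_cmul[symmetric] group_closure_minus_iff .
  show ?thesis
  proof (cases "u v > 0")
    case True
    with pos show ?thesis by blast
  next
    case False
    then have "- u v > 0" using v(2) by simp
    with neg show ?thesis by blast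
  qed
qed

text \<open>
  The form in which full rank is used. From \<open>N\<close> independent elements of \<open>H\<close> one obtains multiples
  of the unit vectors because \<open>N + 1\<close> vectors are dependent. Conversely such multiples are \<open>N\<close>
  independent elements.
\<close>

lemma (in exponent_group) lattice_rank_eq_iff:
  "lattice_rank H = N \<longleftrightarrow> (\<forall>i<N. \<exists>t>0. frag_cmul t (frag_of i) \<in> H)"
proof -
  let ?S = "{card B | B. finite B \<and> B \<subseteq> H \<and> \<not> module.dependent frag_cmul B}"
  have le: "card B \<le> N" if "finite B" "B \<subseteq> H" "\<not> module.dependent frag_cmul B" for B
  proof -
    have "\<not> N < card B" using dependent_if_card_gt[of B N] supported that by blast
    then show ?thesis by simp
  qed
  then have "?S \<subseteq> {..N}" by blast
  then have fin: "finite ?S" using finite_atMost finite_subset by blast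
  have "card ({} :: (nat \<Rightarrow>\<^sub>0 int) set) \<in> ?S" using frag_module.independent_empty by blast
  then have ne: "?S \<noteq> {}" by blast
  show ?thesis
  proof
    assume "lattice_rank H = N"
    then have "N \<in> ?S" using Max_in[OF fin ne] unfolding lattice_rank_def by simp
    then obtain C where C: "finite C" "C \<subseteq> H" "\<not> module.dependent frag_cmul C" "card C = N" by blast
    show "\<forall>i<N. \<exists>t>0. frag_cmul t (frag_of i) \<in> H"
    proof (intro allI impI)
      fix i assume i: "i < N"
      show "\<exists>t>0. frag_cmul t (frag_of i) \<in> H"
      proof (cases "frag_of i \<in> C")
        case True
        then show ?thesis using C by (intro exI[of _ 1]) auto
      next
        case False
        have "module.dependent frag_cmul (insert (frag_of i) C)"
          using C False i supported by (intro dependent_if_card_gt[of _ N]) (auto dest!: supported)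
        from multiple_in_group_closure[OF C(3) this] show ?thesis
          using group_closure_subset[OF C(2)] by blast
      qed
    qed
  next
    assume "\<forall>i<N. \<exists>t>0. frag_cmul t (frag_of i) \<in> H"
    then have "\<forall>i. \<exists>t. i < N \<longrightarrow> t > 0 \<and> frag_cmul t (frag_of i) \<in> H" by blast
    then obtain t where t: "\<And>i. i < N \<Longrightarrow> t i > 0 \<and> frag_cmul (t i) (frag_of i) \<in> H"
      using choice[of "\<lambda>i t. i < N \<longrightarrow> t > 0 \<and> frag_cmul t (frag_of i) \<in> H"] by blast
    define b where "b i = frag_cmul (t i) (frag_of i)" for i
    have lookup_b: "lookup (b i) j = (if j = i then t i else 0)" for i j
      by (simp only: b_def lookup_frag_cmul lookup_frag_of mult_1_right mult_zero_right if_distrib[of "(*) (t i)"])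
    have inj: "inj_on b {..<N}"
    proof (rule inj_onI)
      fix i j assume i: "i \<in> {..<N}" and "b i = b j"
      then have "(if i = j then t j else 0) = t i" using lookup_b[of i i] lookup_b[of j i] by simp
      moreover have "t i > 0" using t i by blast
      ultimately show "i = j" by (cases "i = j") simp_all
    qed
    have "\<not> module.dependent frag_cmul (b ` {..<N})"
    proof
      assume "module.dependent frag_cmul (b ` {..<N})"
      then obtain T u where T: "finite T" "T \<subseteq> b ` {..<N}" "(\<Sum>w\<in>T. frag_cmul (u w) w) = 0" "\<exists>w\<in>T. u w \<noteq> 0"
        unfolding frag_module.dependent_explicit by blast
      then obtain J where J: "J \<subseteq> {..<N}" "T = b ` J" by (auto elim!: subset_imageE)
      then have inj': "inj_on b J" using inj inj_on_subset by blast
      obtain j where j: "j \<in> J" "u (b j) \<noteq> 0" using T(4) J by blast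
      have "0 = lookup (\<Sum>w\<in>T. frag_cmul (u w) w) j" using T(3) by simp
      also have "\<dots> = (\<Sum>i\<in>J. u (b i) * (if j = i then t i else 0))"
        by (simp add: J(2) sum.reindex[OF inj'] lookup_sum lookup_b)
      also have "\<dots> = u (b j) * t j"
        using j finite_subset[OF J(1)] by (simp add: if_distrib cong: if_cong)
      finally have "u (b j) * t j = 0" by simp
      moreover have "t j > 0" using t j J by blast
      ultimately show False using j by simp
    qed
    moreover have "b ` {..<N} \<subseteq> H" using t unfolding b_def by blast
    ultimately have "N \<in> ?S"
      using card_image[OF inj] by (intro CollectI exI[of _ "b ` {..<N}"] conjI) simp_all
    then have "N \<le> Max ?S" by (rule Max_ge[OF fin])
    moreover have "Max ?S \<le> N" using Max_in[OF fin ne] \<open>?S \<subseteq> {..N}\<close> by blast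
    ultimately show "lattice_rank H = N" by (simp add: lattice_rank_def)
  qed
qed

text \<open>
  An independent subset \<open>B\<close> of \<open>A\<close> of maximal cardinality will do: by maximality every element of
  \<open>A\<close>, and then every element of the group generated by \<open>A\<close>, has a positive multiple in the group
  generated by \<open>B\<close>.
\<close>

lemma independent_generators_of_full_rank:
  fixes N :: nat
  assumes A: "\<And>a. a \<in> A \<Longrightarrow> keys a \<subseteq> {..<N}"
    and full: "\<And>i. i < N \<Longrightarrow> \<exists>t>0. frag_cmul t (frag_of i) \<in> group_closure A"
  shows "\<exists>B\<subseteq>A. \<not> module.dependent frag_cmul B \<and>
           (\<forall>i<N. \<exists>t>0. frag_cmul t (frag_of i) \<in> group_closure B)"
proof -
  let ?P = "\<lambda>B. finite B \<and> B \<subseteq> A \<and> \<not> module.dependent frag_cmul B"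
  have "\<forall>B. ?P B \<longrightarrow> card B < Suc N"
  proof (intro allI impI)
    fix B assume B: "?P B"
    then have "\<not> N < card B" using dependent_if_card_gt[of B N] A by blast
    then show "card B < Suc N" by simp
  qed
  moreover have "?P {}" using frag_module.independent_empty by blast
  ultimately obtain B where B: "?P B" and max: "\<And>B'. ?P B' \<Longrightarrow> card B' \<le> card B"
    using ex_has_greatest_nat[of ?P "{}" card "Suc N"] by metis
  have mult_A: "\<exists>k>0. frag_cmul k a \<in> group_closure B" if a: "a \<in> A" for a
  proof (cases "a \<in> B")
    case True
    then show ?thesis by (intro exI[of _ 1]) (auto intro: group_closure.base)
  next
    case False
    then have "module.dependent frag_cmul (insert a B)" using max[of "insert a B"] B a by auto
    then show ?thesis using multiple_in_group_closure B by blast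
  qed
  have cmul: "frag_cmul k a \<in> group_closure B" if "a \<in> group_closure B" for k a
    by (rule frag_closure_minus_cmul) (auto intro: group_closure.intros that)
  have "\<exists>k>0. frag_cmul k a \<in> group_closure B" if "a \<in> group_closure A" for a
    using that
  proof induction
    case (base s)
    then show ?case using mult_A by (auto intro: exI[of _ 1])
  next
    case (diff s t)
    then obtain k l where kl: "k > 0" "frag_cmul k s \<in> group_closure B" "l > 0" "frag_cmul l t \<in> group_closure B"
      by blast
    have "frag_cmul (k * l) (s - t) = frag_cmul l (frag_cmul k s) - frag_cmul k (frag_cmul l t)"
      by (rule poly_mapping_eqI) (simp add: lookup_minus algebra_simps)
    also have "\<dots> \<in> group_closure B"
      using cmul[OF kl(2), of l] cmul[OF kl(4), of k] by (rule group_closure.diff)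
    finally show ?case using kl by (intro exI[of _ "k * l"]) auto
  qed
  note mult = this
  have "\<exists>t>0. frag_cmul t (frag_of i) \<in> group_closure B" if i: "i < N" for i
  proof -
    obtain t k where "t > 0" "k > 0" "frag_cmul k (frag_cmul t (frag_of i)) \<in> group_closure B"
      using full[OF i] mult by blast
    then show ?thesis by (intro exI[of _ "k * t"]) simp
  qed
  then show ?thesis using B by blast
qed

section \<open>The diagonal action\<close>

text \<open>
  The scalar by which \<open>x\<^sup>m\<close> is multiplied when each variable \<open>x\<^sub>i\<close> is multiplied by \<open>c i\<close>.
\<close>

definition weight :: "(nat \<Rightarrow> 'k::field) \<Rightarrow> (nat \<Rightarrow>\<^sub>0 nat) \<Rightarrow> 'k" where
  "weight c m = (\<Prod>i\<in>keys m. c i ^ lookup m i)"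

lemma weight_eq_prod:
  "finite S \<Longrightarrow> keys m \<subseteq> S \<Longrightarrow> weight c m = (\<Prod>i\<in>S. c i ^ lookup m i)"
  unfolding weight_def by (rule prod.mono_neutral_left) (auto simp: in_keys_iff)

lemma weight_add: "weight c (m + n) = weight c m * weight c n"
proof -
  let ?S = "keys m \<union> keys n"
  have "keys (m + n) \<subseteq> ?S" by (rule keys_add)
  then show ?thesis
    by (simp add: weight_eq_prod[of ?S] lookup_add power_add prod.distrib)
qed

lemma weight_0 [simp]: "weight c 0 = 1"
  by (simp add: weight_def)

definition scale_coeffs :: "((nat \<Rightarrow>\<^sub>0 nat) \<Rightarrow> 'k) \<Rightarrow> 'k::field mpol \<Rightarrow> 'k mpol" where
  "scale_coeffs w = Poly_Mapping.mapp (\<lambda>m a. w m * a)"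

lemma lookup_scale_coeffs: "lookup (scale_coeffs w p) m = w m * lookup p m"
  by (simp add: scale_coeffs_def lookup_mapp when_def in_keys_iff)

lemma scale_coeffs_single: "scale_coeffs w (Poly_Mapping.single m a) = Poly_Mapping.single m (w m * a)"
  by (rule poly_mapping_eqI) (simp add: lookup_scale_coeffs lookup_single when_def)

lemma scale_coeffs_sum: "scale_coeffs w (sum f I) = (\<Sum>i\<in>I. scale_coeffs w (f i))"
  by (rule poly_mapping_eqI) (simp add: lookup_scale_coeffs lookup_sum sum_distrib_left)

lemma scale_coeffs_mult:
  assumes "\<And>m n. w (m + n) = w m * w n"
  shows "scale_coeffs w (p * q) = scale_coeffs w p * scale_coeffs w q"
proof -
  have p: "scale_coeffs w p = (\<Sum>m\<in>keys p. Poly_Mapping.single m (w m * lookup p m))" for p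
    by (subst (1) poly_eq_sum_single[of p]) (simp only: scale_coeffs_sum scale_coeffs_single)
  have "p * q = (\<Sum>m\<in>keys p. \<Sum>n\<in>keys q.
      Poly_Mapping.single (m + n) (lookup p m * lookup q n))"
    by (subst (1) poly_eq_sum_single[of p], subst (1) poly_eq_sum_single[of q])
       (simp only: sum_product mult_single)
  then have "scale_coeffs w (p * q) = (\<Sum>m\<in>keys p. \<Sum>n\<in>keys q.
      Poly_Mapping.single (m + n) (w (m + n) * (lookup p m * lookup q n)))"
    by (simp only: scale_coeffs_sum scale_coeffs_single)
  also have "\<dots> = (\<Sum>m\<in>keys p. \<Sum>n\<in>keys q.
      Poly_Mapping.single m (w m * lookup p m) * Poly_Mapping.single n (w n * lookup q n))"
    by (simp add: mult_single assms mult_ac)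
  also have "\<dots> = scale_coeffs w p * scale_coeffs w q"
    by (simp only: p sum_product)
  finally show ?thesis .
qed

lemma scale_coeffs_const: "scale_coeffs (\<lambda>_. a) p = mconst a * p"
proof -
  have "mconst a * p = Poly_Mapping.map ((*) a) p"
    by (simp add: mconst_def mult_map_scale_conv_mult)
  also have "\<dots> = scale_coeffs (\<lambda>_. a) p"
    by (rule poly_mapping_eqI) (simp add: lookup_scale_coeffs map.rep_eq when_def)
  finally show ?thesis ..
qed

lemma monomial_substitution:
  assumes "finite S"
  shows "(\<Prod>i\<in>S. (mconst (c i) * mvar i) ^ k i) =
     (Poly_Mapping.single (\<Sum>i\<in>S. Poly_Mapping.single i (k i)) (\<Prod>i\<in>S. c i ^ k i) :: 'k::field mpol)"
proof -
  have pow: "(mconst a * mvar i) ^ n = (Poly_Mapping.single (Poly_Mapping.single i n) (a ^ n) :: 'k mpol)" for a i n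
    by (induction n) (simp_all add: mconst_def mvar_def mult_single flip: single_add)
  show ?thesis
    using assms by (induction S rule: finite_induct) (simp_all add: pow mult_single)
qed

text \<open>
  Reindexing the sum by \<open>g \<mapsto> h g\<close> multiplies it by \<open>\<psi> h\<close>, which is not \<open>1\<close>.
\<close>

lemma character_sum:
  fixes \<psi> :: "'g \<Rightarrow> 'k::field"
  assumes "group G" "finite (carrier G)"
    and hom: "\<And>g h. g \<in> carrier G \<Longrightarrow> h \<in> carrier G \<Longrightarrow> \<psi> (g \<otimes>\<^bsub>G\<^esub> h) = \<psi> g * \<psi> h"
    and h: "h \<in> carrier G" "\<psi> h \<noteq> 1"
  shows "(\<Sum>g\<in>carrier G. \<psi> g) = 0"
proof -
  interpret group G by fact
  have bij: "bij_betw (\<lambda>g. h \<otimes>\<^bsub>G\<^esub> g) (carrier G) (carrier G)"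
    by (rule bij_betwI[where g = "\<lambda>g. inv\<^bsub>G\<^esub> h \<otimes>\<^bsub>G\<^esub> g"]) (use h in \<open>auto simp: m_assoc[symmetric]\<close>)
  have "(\<Sum>g\<in>carrier G. \<psi> g) = (\<Sum>g\<in>carrier G. \<psi> (h \<otimes>\<^bsub>G\<^esub> g))"
    by (rule sum.reindex_bij_betw[OF bij, symmetric])
  also have "\<dots> = \<psi> h * (\<Sum>g\<in>carrier G. \<psi> g)"
    unfolding sum_distrib_left using h(1) hom by (intro sum.cong) auto
  finally have "(\<psi> h - 1) * (\<Sum>g\<in>carrier G. \<psi> g) = 0" by (simp add: algebra_simps)
  then show ?thesis using h(2) by simp
qed

text \<open>
  Reindexing the product of all values by \<open>g \<mapsto> h g\<close> multiplies it by \<open>\<psi> h\<close> to the power \<open>|G|\<close>.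
\<close>

lemma character_power_order:
  fixes \<psi> :: "'g \<Rightarrow> 'k::field"
  assumes "group G" "finite (carrier G)"
    and hom: "\<And>g h. g \<in> carrier G \<Longrightarrow> h \<in> carrier G \<Longrightarrow> \<psi> (g \<otimes>\<^bsub>G\<^esub> h) = \<psi> g * \<psi> h"
    and nz: "\<And>g. g \<in> carrier G \<Longrightarrow> \<psi> g \<noteq> 0"
    and h: "h \<in> carrier G"
  shows "\<psi> h ^ card (carrier G) = 1"
proof -
  interpret group G by fact
  have bij: "bij_betw (\<lambda>g. h \<otimes>\<^bsub>G\<^esub> g) (carrier G) (carrier G)"
    by (rule bij_betwI[where g = "\<lambda>g. inv\<^bsub>G\<^esub> h \<otimes>\<^bsub>G\<^esub> g"]) (use h in \<open>auto simp: m_assoc[symmetric]\<close>)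
  have "(\<Prod>g\<in>carrier G. \<psi> g) = (\<Prod>g\<in>carrier G. \<psi> (h \<otimes>\<^bsub>G\<^esub> g))"
    by (rule prod.reindex_bij_betw[OF bij, symmetric])
  also have "\<dots> = (\<Prod>g\<in>carrier G. \<psi> h * \<psi> g)"
    using h hom by (intro prod.cong) auto
  also have "\<dots> = \<psi> h ^ card (carrier G) * (\<Prod>g\<in>carrier G. \<psi> g)"
    by (simp add: prod.distrib)
  finally show ?thesis using nz assms(2) by simp
qed

text \<open>
  The consequences of diagonality that the proof needs, with \<open>c g i\<close> the eigenvalue of \<open>g\<close> on \<open>x i\<close>.
  They are derived from a representation in \<open>diagonal_action_weights\<close>.
\<close>

locale diagonal_action = group G for G :: "('g, 'b) monoid_scheme" (structure) +
  fixes \<rho> :: "'g \<Rightarrow> 'v \<Rightarrow> 'v" and N :: nat and x :: "nat \<Rightarrow> 'v \<Rightarrow> 'k::field"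
    and c :: "'g \<Rightarrow> nat \<Rightarrow> 'k"
  assumes finite_G: "finite (carrier G)"
    and char: "\<not> CHAR('k) dvd card (carrier G)"
    and linear_form_eq: "\<And>g i. g \<in> carrier G \<Longrightarrow> i < N \<Longrightarrow>
          linear_form N x (dual_act G \<rho> g (x i)) = mconst (c g i) * mvar i"
    and c_mult: "\<And>g h i. g \<in> carrier G \<Longrightarrow> h \<in> carrier G \<Longrightarrow> i < N \<Longrightarrow> c (g \<otimes> h) i = c g i * c h i"
    and c_nonzero: "\<And>g i. g \<in> carrier G \<Longrightarrow> i < N \<Longrightarrow> c g i \<noteq> 0"
begin

abbreviation "L \<equiv> inv_lattice G \<rho> N x"

abbreviation act :: "'g \<Rightarrow> 'k mpol \<Rightarrow> 'k mpol" where
  "act g \<equiv> scale_coeffs (weight (c g))"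

lemma poly_act_eq:
  assumes g: "g \<in> carrier G" and p: "p \<in> polys N"
  shows "poly_act G \<rho> N x g p = act g p"
proof -
  have "poly_act G \<rho> N x g p = (\<Sum>m\<in>keys p. act g (Poly_Mapping.single m (lookup p m)))"
    unfolding poly_act_def
  proof (intro sum.cong refl)
    fix m assume m: "m \<in> keys p"
    have "(\<Prod>i\<in>keys m. linear_form N x (dual_act G \<rho> g (x i)) ^ lookup m i)
        = (\<Prod>i\<in>keys m. (mconst (c g i) * mvar i) ^ lookup m i)"
      using g polys_keys[OF p m] by (intro prod.cong) (auto simp: linear_form_eq)
    also have "\<dots> = Poly_Mapping.single (\<Sum>i\<in>keys m. Poly_Mapping.single i (lookup m i)) (weight (c g) m)"
      by (simp add: monomial_substitution weight_def)
    also have "(\<Sum>i\<in>keys m. Poly_Mapping.single i (lookup m i)) = m"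
      by (rule poly_eq_sum_single[symmetric])
    finally show "mconst (lookup p m) *
        (\<Prod>i\<in>keys m. linear_form N x (dual_act G \<rho> g (x i)) ^ lookup m i)
        = act g (Poly_Mapping.single m (lookup p m))"
      by (simp add: mconst_def mult_single scale_coeffs_single mult.commute)
  qed
  also have "\<dots> = act g p"
    unfolding scale_coeffs_sum[symmetric] poly_eq_sum_single[symmetric] ..
  finally show ?thesis .
qed

lemma weight_nonzero:
  "g \<in> carrier G \<Longrightarrow> keys m \<subseteq> {..<N} \<Longrightarrow> weight (c g) m \<noteq> 0"
  using c_nonzero by (auto simp: weight_def)

lemma weight_mult:
  assumes "g \<in> carrier G" "h \<in> carrier G" "keys m \<subseteq> {..<N}"
  shows "weight (c (g \<otimes> h)) m = weight (c g) m * weight (c h) m"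
  unfolding weight_def prod.distrib[symmetric]
  using assms by (intro prod.cong) (auto simp: c_mult power_mult_distrib)

lemma act_mult: "act g (p * q) = act g p * act g q"
  by (rule scale_coeffs_mult) (rule weight_add)

lemma act_nonzero:
  assumes g: "g \<in> carrier G" and p: "p \<in> polys N" "p \<noteq> 0"
  shows "act g p \<noteq> 0"
proof
  assume z: "act g p = 0"
  obtain m where m: "m \<in> keys p" using p(2) by (metis keys_eq_empty all_not_in_conv)
  have "weight (c g) m * lookup p m = 0"
    using z by (metis lookup_scale_coeffs lookup_zero)
  then show False using weight_nonzero[OF g polys_keys[OF p(1) m]] m by (simp add: in_keys_iff)
qed

lemma ratfun_act_Fract:
  assumes g: "g \<in> carrier G" and pq: "p \<in> polys N" "q \<in> polys N" "q \<noteq> 0"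
  shows "ratfun_act G \<rho> N x g (Fract p q) = Fract (act g p) (act g q)"
  unfolding ratfun_act_def
proof (rule the_equality)
  show "\<exists>p'\<in>polys N. \<exists>q'\<in>polys N. q' \<noteq> 0 \<and> Fract p q = Fract p' q' \<and>
      Fract (act g p) (act g q) = Fract (poly_act G \<rho> N x g p') (poly_act G \<rho> N x g q')"
    using pq by (intro bexI[of _ p] bexI[of _ q]) (simp_all add: poly_act_eq[OF g])
  fix h
  assume "\<exists>p'\<in>polys N. \<exists>q'\<in>polys N. q' \<noteq> 0 \<and> Fract p q = Fract p' q' \<and>
      h = Fract (poly_act G \<rho> N x g p') (poly_act G \<rho> N x g q')"
  then obtain p' q' where pq': "p' \<in> polys N" "q' \<in> polys N" "q' \<noteq> 0" "Fract p q = Fract p' q'"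
    and h: "h = Fract (act g p') (act g q')"
    by (auto simp: poly_act_eq[OF g])
  then have "p * q' = p' * q" using pq by (simp add: eq_fract)
  then have "act g p * act g q' = act g p' * act g q" by (metis act_mult)
  then show "h = Fract (act g p) (act g q)"
    using act_nonzero[OF g] pq pq' by (simp add: h eq_fract)
qed

lemma invariant_Fract_iff:
  assumes pq: "p \<in> polys N" "q \<in> polys N" "q \<noteq> 0"
  shows "Fract p q \<in> inv_field G \<rho> N x \<longleftrightarrow> (\<forall>g\<in>carrier G. act g p * q = p * act g q)"
proof -
  have "Fract p q \<in> ratfuns N" using pq by (auto simp: ratfuns_def)
  then show ?thesis
    using pq by (simp add: inv_field_def ratfun_act_Fract act_nonzero eq_fract)
qed

text \<open>
  Phrasing invariance of \<open>x\<^sup>a\<close> through a difference \<open>a = m - n\<close> of nonnegative exponents reduces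
  it to the action on polynomials.
\<close>

lemma diff_in_inv_lattice_iff:
  assumes m: "keys m \<subseteq> {..<N}" and n: "keys n \<subseteq> {..<N}"
  shows "iexp m - iexp n \<in> L \<longleftrightarrow> (\<forall>g\<in>carrier G. weight (c g) m = weight (c g) n)"
proof -
  have L: "laurent_monomial N (iexp m - iexp n) = (Fract (mon m) (mon n) :: 'k ratf)"
    using m n by (simp add: laurent_monomial_diff Fract_conv_to_fract to_fract_mon[of _ N])
  have "keys (iexp m - iexp n) \<subseteq> {..<N}"
    using m n keys_diff[of "iexp m" "iexp n"] by auto
  moreover have "(laurent_monomial N (iexp m - iexp n) :: 'k ratf) \<in> ratfuns N"
    unfolding L ratfuns_def using m n single_in_polys mon_nonzero by blast
  ultimately have "iexp m - iexp n \<in> L \<longleftrightarrow> laurent_monomial N (iexp m - iexp n) \<in> inv_field G \<rho> N x"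
    by (simp add: inv_lattice_def inv_field_def)
  also have "\<dots> \<longleftrightarrow> (\<forall>g\<in>carrier G. 
      Poly_Mapping.single (m + n) (weight (c g) m) = Poly_Mapping.single (m + n) (weight (c g) n))"
    unfolding L using m n by (subst invariant_Fract_iff) (simp_all add: single_in_polys scale_coeffs_single mult_single)
  also have "\<dots> \<longleftrightarrow> (\<forall>g\<in>carrier G. weight (c g) m = weight (c g) n)"
    by (metis lookup_single_eq)
  finally show ?thesis .
qed

sublocale lattice: exponent_group N L
proof
  show supp: "keys a \<subseteq> {..<N}" if "a \<in> L" for a
    using that by (auto simp: inv_lattice_def)
  show "0 \<in> L" using diff_in_inv_lattice_iff[of 0 0] by simp
  fix a b assume ab: "a \<in> L" "b \<in> L"
  have k: "keys (pos_exp a) \<subseteq> {..<N}" "keys (pos_exp (- a)) \<subseteq> {..<N}"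
       "keys (pos_exp b) \<subseteq> {..<N}" "keys (pos_exp (- b)) \<subseteq> {..<N}"
    using supp[OF ab(1)] supp[OF ab(2)] keys_pos_exp[of a] keys_pos_exp[of "- a"]
      keys_pos_exp[of b] keys_pos_exp[of "- b"]
    by auto
  have k': "keys (pos_exp a + pos_exp (- b)) \<subseteq> {..<N}" "keys (pos_exp (- a) + pos_exp b) \<subseteq> {..<N}"
    using k keys_add[of "pos_exp a" "pos_exp (- b)"] keys_add[of "pos_exp (- a)" "pos_exp b"] by auto
  have "\<forall>g\<in>carrier G. weight (c g) (pos_exp a) = weight (c g) (pos_exp (- a))"
       "\<forall>g\<in>carrier G. weight (c g) (pos_exp b) = weight (c g) (pos_exp (- b))"
    using ab diff_in_inv_lattice_iff[OF k(1,2)] diff_in_inv_lattice_iff[OF k(3,4)]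
    by (simp_all add: pos_exp_decomp)
  then have "iexp (pos_exp a + pos_exp (- b)) - iexp (pos_exp (- a) + pos_exp b) \<in> L"
    unfolding diff_in_inv_lattice_iff[OF k'] by (simp add: weight_add)
  also have "iexp (pos_exp a + pos_exp (- b)) - iexp (pos_exp (- a) + pos_exp b)
      = (iexp (pos_exp a) - iexp (pos_exp (- a))) - (iexp (pos_exp b) - iexp (pos_exp (- b)))"
    by (simp add: iexp_add)
  finally show "a - b \<in> L" by (simp only: pos_exp_decomp)
qed

lemma order_multiple_in_lattice:
  assumes "i < N"
  shows "frag_cmul (int (card (carrier G))) (frag_of i) \<in> L"
proof -
  let ?m = "Poly_Mapping.single i (card (carrier G))"
  have "frag_cmul (int (card (carrier G))) (frag_of i) = iexp ?m - iexp 0"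
    by (rule poly_mapping_eqI) (simp add: lookup_single when_def)
  moreover have "c g i ^ card (carrier G) = 1" if "g \<in> carrier G" for g
    using that assms by (intro character_power_order[where \<psi> = "\<lambda>g. c g i"]) (auto simp: finite_G c_mult c_nonzero is_group)
  then have "weight (c g) ?m = weight (c g) 0" if "g \<in> carrier G" for g
    using that weight_eq_prod[of "{i}" ?m "c g"] by simp
  ultimately show ?thesis
    using assms by (simp only:) (subst diff_in_inv_lattice_iff, auto)
qed

text \<open>
  The monomials on which \<open>G\<close> acts through the same character as on \<open>x\<^sup>n\<close>.
\<close>

definition isotypic :: "(nat \<Rightarrow>\<^sub>0 nat) \<Rightarrow> (nat \<Rightarrow>\<^sub>0 nat) set" where
  "isotypic n = {m. keys m \<subseteq> {..<N} \<and> (\<forall>g\<in>carrier G. weight (c g) m = weight (c g) n)}"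

text \<open>
  The averaging operator of a character, multiplied by \<open>|G|\<close>, in terms of monomials. By
  orthogonality of characters it annihilates all monomials of a different character.
\<close>

lemma isotypic_projection:
  assumes p: "p \<in> polys N" and n: "keys n \<subseteq> {..<N}"
  shows "(\<Sum>g\<in>carrier G. mconst (inverse (weight (c g) n)) * act g p)
       = mconst (of_nat (card (carrier G))) * monomial_part (isotypic n) p"
proof (rule poly_mapping_eqI)
  fix m
  have "(\<Sum>g\<in>carrier G. inverse (weight (c g) n) * (weight (c g) m * lookup p m))
      = of_nat (card (carrier G)) * (lookup p m when m \<in> isotypic n)"
  proof (cases "m \<in> keys p")
    case True
    then have m: "keys m \<subseteq> {..<N}" using p polys_keys by blast
    define \<psi> where "\<psi> g = inverse (weight (c g) n) * weight (c g) m" for g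
    have "(\<Sum>g\<in>carrier G. \<psi> g) = (of_nat (card (carrier G)) when m \<in> isotypic n)"
    proof (cases "m \<in> isotypic n")
      case True
      then have "\<psi> g = 1" if "g \<in> carrier G" for g
        using weight_nonzero[OF that n] that by (simp add: \<psi>_def isotypic_def)
      then show ?thesis using True by simp
    next
      case False
      then obtain h where h: "h \<in> carrier G" "weight (c h) m \<noteq> weight (c h) n"
        using m by (auto simp: isotypic_def)
      have "(\<Sum>g\<in>carrier G. \<psi> g) = 0"
      proof (rule character_sum[OF is_group finite_G])
        show "\<psi> (g \<otimes> h) = \<psi> g * \<psi> h" if "g \<in> carrier G" "h \<in> carrier G" for g h
          using that m n by (simp add: \<psi>_def weight_mult)
        show "h \<in> carrier G" by fact
        show "\<psi> h \<noteq> 1" using h weight_nonzero[OF h(1) n] by (simp add: \<psi>_def field_simps)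
      qed
      then show ?thesis using False by simp
    qed
    then have "(\<Sum>g\<in>carrier G. \<psi> g) * lookup p m
        = of_nat (card (carrier G)) * (lookup p m when m \<in> isotypic n)"
      by (simp add: when_def)
    then show ?thesis by (simp add: \<psi>_def sum_distrib_right mult.assoc)
  next
    case False
    then show ?thesis by (simp add: in_keys_iff)
  qed
  then show "lookup (\<Sum>g\<in>carrier G. mconst (inverse (weight (c g) n)) * act g p) m
    = lookup (mconst (of_nat (card (carrier G))) * monomial_part (isotypic n) p) m"
    by (simp add: lookup_sum lookup_scale_coeffs lookup_monomial_part flip: scale_coeffs_const)
qed

text \<open>
  If \<open>p = f q\<close> with \<open>f\<close> invariant, averaging against a character gives \<open>p\<^sub>\<chi> = f q\<^sub>\<chi>\<close>; the character
  is taken from a monomial of \<open>q\<close> so that \<open>q\<^sub>\<chi> \<noteq> 0\<close>. The factor \<open>|G|\<close> can be cancelled because the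
  characteristic does not divide it.
\<close>

lemma invariant_eq_isotypic_quotient:
  assumes pq: "p \<in> polys N" "q \<in> polys N" "q \<noteq> 0" and inv: "Fract p q \<in> inv_field G \<rho> N x"
  shows "\<exists>n. monomial_part (isotypic n) q \<noteq> 0 \<and>
           Fract p q = Fract (monomial_part (isotypic n) p) (monomial_part (isotypic n) q)"
proof -
  obtain n where n: "n \<in> keys q" using pq(3) by (metis keys_eq_empty all_not_in_conv)
  then have nN: "keys n \<subseteq> {..<N}" using pq polys_keys by blast
  then have "n \<in> keys (monomial_part (isotypic n) q)"
    using n by (simp add: keys_monomial_part isotypic_def)
  then have nz: "monomial_part (isotypic n) q \<noteq> 0" by auto
  let ?C = "mconst (of_nat (card (carrier G))) :: 'k mpol"
  have "(of_nat (card (carrier G)) :: 'k) \<noteq> 0"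
    using char by (simp add: of_nat_eq_0_iff_char_dvd)
  then have C: "?C \<noteq> 0" unfolding mconst_def by (metis lookup_single_eq lookup_zero)
  have inv': "\<forall>g\<in>carrier G. act g p * q = p * act g q"
    using inv invariant_Fract_iff[OF pq] by blast
  have "?C * monomial_part (isotypic n) p * q =
      (\<Sum>g\<in>carrier G. mconst (inverse (weight (c g) n)) * (act g p * q))"
    unfolding isotypic_projection[OF pq(1) nN, symmetric] by (simp add: sum_distrib_right mult.assoc)
  also have "\<dots> = (\<Sum>g\<in>carrier G. mconst (inverse (weight (c g) n)) * (p * act g q))"
    using inv' by (intro sum.cong) auto
  also have "\<dots> = p * (?C * monomial_part (isotypic n) q)"
    unfolding isotypic_projection[OF pq(2) nN, symmetric] by (simp add: sum_distrib_left mult_ac)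
  finally have "?C * (monomial_part (isotypic n) p * q) = ?C * (p * monomial_part (isotypic n) q)"
    by (simp add: mult_ac)
  then have "monomial_part (isotypic n) p * q = p * monomial_part (isotypic n) q"
    using C by (metis mult_left_cancel)
  then have "Fract p q = Fract (monomial_part (isotypic n) p) (monomial_part (isotypic n) q)"
    using nz pq(3) by (simp add: eq_fract)
  with nz show ?thesis by blast
qed

end

section \<open>Invariants of bounded degree\<close>

text \<open>
  For \<open>d > 0\<close> the point \<open>u\<close> of the cross-polytope with \<open>a = d u\<close> can only be \<open>a/d\<close>.
\<close>

lemma mem_lattice_points_iff:
  assumes a: "keys a \<subseteq> {..<N}" and d: "d > 0"
  shows "a \<in> lattice_points N d \<longleftrightarrow> (\<Sum>i<N. \<bar>lookup a i\<bar>) \<le> int d"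
proof -
  let ?u = "\<lambda>i. of_int (lookup a i) / real d"
  have "a \<in> lattice_points N d \<longleftrightarrow> ?u \<in> cross_polytope N"
  proof
    assume "a \<in> lattice_points N d"
    then obtain u where u: "u \<in> cross_polytope N" "\<And>i. of_int (lookup a i) = real d * u i"
      by (auto simp: lattice_points_def)
    then have "?u = u" using d by (auto simp: fun_eq_iff)
    then show "?u \<in> cross_polytope N" using u by simp
  next
    assume "?u \<in> cross_polytope N"
    then show "a \<in> lattice_points N d"
      using d by (auto simp: lattice_points_def intro!: bexI[of _ ?u])
  qed
  also have "\<dots> \<longleftrightarrow> (\<Sum>i<N. \<bar>?u i\<bar>) \<le> 1"
    using a by (auto simp: cross_polytope_def in_keys_iff subset_iff)
  also have "(\<Sum>i<N. \<bar>?u i\<bar>) = of_int (\<Sum>i<N. \<bar>lookup a i\<bar>) / real d"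
    by (simp add: sum_divide_distrib)
  also have "\<dots> \<le> 1 \<longleftrightarrow> (\<Sum>i<N. \<bar>lookup a i\<bar>) \<le> int d"
  proof -
    have "(of_int (\<Sum>i<N. \<bar>lookup a i\<bar>) / real d \<le> 1) \<longleftrightarrow>
        real_of_int (\<Sum>i<N. \<bar>lookup a i\<bar>) \<le> real_of_int (int d)"
      using d by (simp add: divide_le_eq del: of_int_sum)
    then show ?thesis by (simp only: of_int_le_iff)
  qed
  finally show ?thesis .
qed

context diagonal_action
begin

abbreviation "F \<equiv> inv_field G \<rho> N x"
abbreviation "F_le \<equiv> inv_field_le G \<rho> N x"
abbreviation "gens d \<equiv> L \<inter> lattice_points N d"

lemma gens_supported: "a \<in> gens d \<Longrightarrow> keys a \<subseteq> {..<N}"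
  using lattice.supported by blast

lemma gens_group: "exponent_group N (group_closure (gens d))"
  by (rule exponent_group_group_closure) (rule gens_supported)

lemma laurent_monomial_in_inv_field: "a \<in> L \<Longrightarrow> laurent_monomial N a \<in> F"
proof -
  assume a: "a \<in> L"
  then have "(laurent_monomial N a :: 'k ratf) \<in> ratfuns N"
    using lattice.laurent_monomial_mem_iff[of a] lattice.supported lattice.coset_fractions_subset_ratfuns by blast
  then show ?thesis using a by (simp add: inv_lattice_def inv_field_def)
qed

text \<open>
  All monomials of \<open>p\<close> and \<open>q\<close> have the same character, so \<open>g\<close> multiplies both by the same scalar.
\<close>

lemma coset_fractions_subset_inv_field: "coset_fractions N L \<subseteq> F"
proof
  fix f :: "'k ratf" assume "f \<in> coset_fractions N L"
  then obtain p q where pq: "p \<in> polys N" "q \<in> polys N" "q \<noteq> 0" "f = Fract p q"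
    and M: "congruent_exps L (keys p \<union> keys q)"
    by (auto simp: coset_fractions_def)
  obtain n where n: "n \<in> keys q" using pq(3) by (metis keys_eq_empty all_not_in_conv)
  have *: "act g r = mconst (weight (c g) n) * r"
    if g: "g \<in> carrier G" and r: "r \<in> polys N" "keys r \<subseteq> keys p \<union> keys q" for g r
    unfolding scale_coeffs_const[symmetric]
  proof (rule poly_mapping_eqI)
    fix m
    have "weight (c g) m = weight (c g) n" if m: "m \<in> keys r"
    proof -
      have "iexp m - iexp n \<in> L" using M m n r(2) by (auto simp: congruent_exps_def)
      then show ?thesis
        using diff_in_inv_lattice_iff[of m n] polys_keys[OF r(1) m] polys_keys[OF pq(2) n] g by blast
    qed
    then show "lookup (act g r) m = lookup (scale_coeffs (\<lambda>_. weight (c g) n) r) m"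
      by (cases "m \<in> keys r") (simp_all add: lookup_scale_coeffs in_keys_iff)
  qed
  have "act g p * q = p * act g q" if "g \<in> carrier G" for g
    using *[OF that pq(1)] *[OF that pq(2)] by simp
  then show "f \<in> F" unfolding pq(4) invariant_Fract_iff[OF pq(1-3)] by blast
qed

text \<open>
  After passing to isotypic components, the differences between exponents of the numerator and
  of the denominator are invariant and bounded by the degree. Differences between two exponents
  of the denominator may be too long, but they are differences of two short ones, through an
  exponent of the numerator.
\<close>

lemma inv_field_le_subset_coset_fractions:
  assumes d: "d > 0"
  shows "F_le d \<subseteq> coset_fractions N (group_closure (gens d))"
proof
  fix f assume f: "f \<in> F_le d"
  interpret H: exponent_group N "group_closure (gens d)" by (rule gens_group)
  have "f \<in> ratfuns N" "f \<in> F" using f by (auto simp: inv_field_le_def inv_field_def)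
  then obtain p q where pq: "p \<in> polys N" "q \<in> polys N" "q \<noteq> 0" "f = Fract p q"
    and deg: "total_degree p + total_degree q \<le> d"
    using ratfun_degree_witness[of f N] f by (auto simp: inv_field_le_def)
  obtain k where k: "monomial_part (isotypic k) q \<noteq> 0"
      "f = Fract (monomial_part (isotypic k) p) (monomial_part (isotypic k) q)"
    using invariant_eq_isotypic_quotient[OF pq(1-3)] \<open>f \<in> F\<close> pq(4) by blast
  let ?p = "monomial_part (isotypic k) p" and ?q = "monomial_part (isotypic k) q"
  have polys: "?p \<in> polys N" "?q \<in> polys N" using pq by (auto intro: monomial_part_in_polys)
  have diff: "iexp m - iexp n \<in> group_closure (gens d)"
    if m: "m \<in> keys ?p" and n: "n \<in> keys ?q" for m n
  proof -
    have mn: "keys m \<subseteq> {..<N}" "keys n \<subseteq> {..<N}" "m \<in> isotypic k" "n \<in> isotypic k"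
      using m n by (auto simp: keys_monomial_part isotypic_def)
    then have L: "iexp m - iexp n \<in> L"
      by (simp add: diff_in_inv_lattice_iff isotypic_def)
    have "(\<Sum>i<N. \<bar>lookup (iexp m - iexp n) i\<bar>)
        \<le> (\<Sum>i<N. int (lookup m i) + int (lookup n i))"
      by (intro sum_mono) (simp add: lookup_minus)
    also have "\<dots> = int (mdeg m + mdeg n)"
      using mn by (simp add: mdeg_eq_sum[of "{..<N}"] sum.distrib)
    also have "\<dots> \<le> int d"
      using deg mdeg_le_total_degree[of m p] mdeg_le_total_degree[of n q] m n by (simp add: keys_monomial_part)
    finally have "iexp m - iexp n \<in> gens d"
      using L mem_lattice_points_iff[OF lattice.supported[OF L] d] by simp
    then show ?thesis by (auto intro: group_closure.base)
  qed
  show "f \<in> coset_fractions N (group_closure (gens d))"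
  proof (cases "?p = 0")
    case True
    then have "f = 0" using k by (simp add: Fract_conv_to_fract)
    then show ?thesis using H.is_subfield_coset_fractions by (auto simp: is_subfield_def)
  next
    case False
    then obtain m where m: "m \<in> keys ?p" by (metis keys_eq_empty all_not_in_conv)
    obtain n where n: "n \<in> keys ?q" using k(1) by (metis keys_eq_empty all_not_in_conv)
    \<comment> \<open>Exponents of the denominator are related to \<open>n\<close> by way of \<open>m\<close>.\<close>
    have rel: "iexp a - iexp n \<in> group_closure (gens d)"
      if "a \<in> keys ?p \<union> keys ?q" for a
    proof (cases "a \<in> keys ?p")
      case True
      then show ?thesis using diff n by blast
    next
      case False
      then have "(iexp m - iexp n) - (iexp m - iexp a) \<in> group_closure (gens d)"
        using that by (intro group_closure.diff diff m n) auto
      then show ?thesis by simp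
    qed
    have "congruent_exps (group_closure (gens d)) (keys ?p \<union> keys ?q)"
      unfolding congruent_exps_def
    proof (intro ballI)
      fix a b assume "a \<in> keys ?p \<union> keys ?q" "b \<in> keys ?p \<union> keys ?q"
      then have "(iexp a - iexp n) - (iexp b - iexp n) \<in> group_closure (gens d)"
        by (intro group_closure.diff rel)
      then show "iexp a - iexp b \<in> group_closure (gens d)" by simp
    qed
    then show ?thesis unfolding k(2) using polys k(1) by (intro H.coset_fractionsI)
  qed
qed

lemma laurent_monomial_gens_in_inv_field_le:
  assumes d: "d > 0" and a: "a \<in> gens d"
  shows "laurent_monomial N a \<in> F_le d"
proof -
  have "int (ratfun_degree N (laurent_monomial N a :: 'k ratf)) \<le> int d"
    using a mem_lattice_points_iff[OF gens_supported[OF a] d]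
    by (simp add: ratfun_degree_laurent_monomial[OF gens_supported[OF a]])
  then show ?thesis using a laurent_monomial_in_inv_field by (simp add: inv_field_le_def)
qed

lemma field_adjoin_inv_field_le:
  assumes d: "d > 0"
  shows "field_adjoin (F_le d) = coset_fractions N (group_closure (gens d))"
proof
  interpret H: exponent_group N "group_closure (gens d)" by (rule gens_group)
  show "field_adjoin (F_le d) \<subseteq> coset_fractions N (group_closure (gens d))"
    using inv_field_le_subset_coset_fractions[OF d] H.rconst_mem
    by (intro field_adjoin_least H.is_subfield_coset_fractions) auto
  have "coset_fractions N (group_closure (gens d)) = field_adjoin (laurent_monomial N ` gens d :: 'k ratf set)"
    by (rule field_adjoin_laurent_monomials[symmetric]) (rule gens_supported)
  also have "\<dots> \<subseteq> field_adjoin (F_le d)"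
    using laurent_monomial_gens_in_inv_field_le[OF d] field_adjoin_subset[of "F_le d"]
    by (intro field_adjoin_least is_subfield_field_adjoin rconst_in_field_adjoin) blast
  finally show "coset_fractions N (group_closure (gens d)) \<subseteq> field_adjoin (F_le d)" .
qed

lemma group_closure_gens_subset: "group_closure (gens d) \<subseteq> L"
  by (rule lattice.group_closure_subset) simp

text \<open>
  Every invariant has some degree, so \<open>inv_field_le_subset_coset_fractions\<close> applies to it for a
  suitable \<open>d\<close>; the successor only ensures that \<open>d\<close> is positive.
\<close>

lemma inv_field_eq: "F = coset_fractions N L"
proof
  show "F \<subseteq> coset_fractions N L"
  proof
    fix f assume f: "f \<in> F"
    have "f \<in> F_le (Suc (ratfun_degree N f))" using f by (simp add: inv_field_le_def)
    then have "f \<in> coset_fractions N (group_closure (gens (Suc (ratfun_degree N f))))"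
      using inv_field_le_subset_coset_fractions by blast
    then show "f \<in> coset_fractions N L"
      using group_closure_gens_subset congruent_exps_def unfolding coset_fractions_def congruent_exps_def by blast
  qed
qed (rule coset_fractions_subset_inv_field)

lemma generates_inv_field_iff:
  assumes d: "d > 0"
  shows "field_adjoin (F_le d) = F \<longleftrightarrow> L = group_closure (gens d)"
proof
  assume "field_adjoin (F_le d) = F"
  then have eq: "coset_fractions N (group_closure (gens d)) = (coset_fractions N L :: 'k ratf set)"
    using field_adjoin_inv_field_le[OF d] inv_field_eq by simp
  interpret H: exponent_group N "group_closure (gens d)" by (rule gens_group)
  have "a \<in> group_closure (gens d)" if a: "a \<in> L" for a
    using a lattice.laurent_monomial_mem_iff[of a, where 'k = 'k] H.laurent_monomial_mem_iff[of a, where 'k = 'k]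
      lattice.supported[OF a] eq by simp
  then show "L = group_closure (gens d)" using group_closure_gens_subset by blast
next
  assume "L = group_closure (gens d)"
  then show "field_adjoin (F_le d) = F"
    using field_adjoin_inv_field_le[OF d] inv_field_eq by simp
qed

text \<open>
  From left to right, a transcendence basis makes every invariant algebraic over the field of the
  generated lattice, in particular the invariants \<open>x\<^sub>i\<close> to the power \<open>|G|\<close>. From right to left, the
  basis consists of Laurent monomials.
\<close>

lemma contains_transcendence_basis_iff:
  assumes d: "d > 0"
  shows "(\<exists>B\<subseteq>F_le d. transcendence_basis F B) \<longleftrightarrow> lattice_rank (group_closure (gens d)) = N"
proof -
  interpret H: exponent_group N "group_closure (gens d)" by (rule gens_group)
  show ?thesis unfolding H.lattice_rank_eq_iff
  proof
    assume "\<exists>B\<subseteq>F_le d. transcendence_basis F B"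
    then obtain B where B: "B \<subseteq> F_le d" "\<And>y. y \<in> F \<Longrightarrow> algebraic_over (field_adjoin B) y"
      by (auto simp: transcendence_basis_def)
    have sub: "field_adjoin B \<subseteq> coset_fractions N (group_closure (gens d))"
      using B(1) inv_field_le_subset_coset_fractions[OF d] H.rconst_mem
      by (intro field_adjoin_least H.is_subfield_coset_fractions) auto
    show "\<forall>i<N. \<exists>t>0. frag_cmul t (frag_of i) \<in> group_closure (gens d)"
    proof (intro allI impI)
      fix i assume i: "i < N"
      let ?a = "frag_cmul (int (card (carrier G))) (frag_of i)"
      have a: "?a \<in> L" using i by (rule order_multiple_in_lattice)
      have "algebraic_over (coset_fractions N (group_closure (gens d))) (laurent_monomial N ?a :: 'k ratf)"
        using B(2)[OF laurent_monomial_in_inv_field[OF a]] sub by (rule algebraic_over_mono)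
      then obtain t where "t > 0" "frag_cmul t ?a \<in> group_closure (gens d)"
        using H.algebraic_laurent_monomial_multiple lattice.supported[OF a] by blast
      moreover have "card (carrier G) > 0" using finite_G by (simp add: card_gt_0_iff) blast
      ultimately show "\<exists>t>0. frag_cmul t (frag_of i) \<in> group_closure (gens d)"
        by (intro exI[of _ "t * int (card (carrier G))"]) simp
    qed
  next
    assume "\<forall>i<N. \<exists>t>0. frag_cmul t (frag_of i) \<in> group_closure (gens d)"
    then obtain B where B: "B \<subseteq> gens d" "\<not> module.dependent frag_cmul B"
      and full: "\<And>i. i < N \<Longrightarrow> \<exists>t>0. frag_cmul t (frag_of i) \<in> group_closure B"
      using independent_generators_of_full_rank[of "gens d" N] gens_supported by blast
    have suppB: "keys b \<subseteq> {..<N}" if "b \<in> B" for b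
      using that B(1) gens_supported by blast
    interpret HB: exponent_group N "group_closure B"
      using suppB by (rule exponent_group_group_closure)
    let ?X = "laurent_monomial N ` B :: 'k ratf set"
    have X: "?X \<subseteq> F_le d" using B(1) laurent_monomial_gens_in_inv_field_le[OF d] by blast
    have "transcendence_basis F ?X"
      unfolding transcendence_basis_def
    proof (intro conjI ballI)
      show "?X \<subseteq> F" using X by (auto simp: inv_field_le_def)
      show "alg_independent ?X" using suppB B(2) by (rule alg_independent_laurent_monomials)
      fix y assume "y \<in> F"
      then have "y \<in> ratfuns N" by (simp add: inv_field_def)
      with full have "algebraic_over (coset_fractions N (group_closure B)) y"
        by (rule HB.ratfuns_algebraic)
      then show "algebraic_over (field_adjoin ?X) y"
        using field_adjoin_laurent_monomials[OF suppB, where 'k = 'k] by simp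
    qed
    then show "\<exists>B\<subseteq>F_le d. transcendence_basis F B" using X by blast
  qed
qed

end

section \<open>The weights of a diagonal representation\<close>

lemma coords_scalar_multiple:
  assumes basis: "dual_basis scale N x" and i: "i < N"
    and dual: "(\<lambda>v. a * x i v) \<in> dual_space scale"
  shows "coords N x (\<lambda>v. a * x i v) = (\<lambda>j. if j = i then a else 0)"
proof -
  let ?e = "\<lambda>j. if j = i then a else 0"
  have "is_coords N x (\<lambda>v. a * x i v) ?e"
    using i by (auto simp: is_coords_def fun_eq_iff if_distrib[of "\<lambda>t. t * _"] cong: if_cong)
  moreover have "\<exists>!c. is_coords N x (\<lambda>v. a * x i v) c"
    using basis dual by (auto simp: dual_basis_def)
  ultimately show ?thesis unfolding coords_def by (metis the1_equality)
qed

lemma dual_space_scalar_multiple: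
  assumes "\<phi> \<in> dual_space scale" shows "(\<lambda>v. a * \<phi> v) \<in> dual_space scale"
  using assms
  by (auto simp: dual_space_def Vector_Spaces.linear_def module_hom_def module_hom_axioms_def algebra_simps)

text \<open>
  If \<open>x i\<close> vanished, both the \<open>i\<close>-th unit vector and the zero vector would be coordinates of it.
\<close>

lemma dual_basis_nonzero:
  fixes x :: "nat \<Rightarrow> 'v::ab_group_add \<Rightarrow> 'k::field"
  assumes basis: "dual_basis scale N x" and i: "i < N"
  shows "\<exists>v. x i v \<noteq> 0"
proof (rule ccontr)
  assume "\<not> (\<exists>v. x i v \<noteq> 0)"
  then have z: "(\<lambda>v. 1 * x i v) = (\<lambda>v. 0 * x i v)" by auto
  have "x i \<in> dual_space scale" using basis i by (auto simp: dual_basis_def)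
  then have "coords N x (\<lambda>v. a * x i v) = (\<lambda>j. if j = i then a else 0)" for a
    by (intro coords_scalar_multiple[OF basis i] dual_space_scalar_multiple)
  from this[of 1] this[of 0] have "(\<lambda>j. if j = i then 1 else 0 :: 'k) = (\<lambda>j. if j = i then 0 else 0)"
    using z by simp
  from fun_cong[OF this, of i] show False by simp
qed

text \<open>
  Evaluating at a vector where \<open>x i\<close> does not vanish shows that the eigenvalues are multiplicative
  in \<open>g\<close> and that the neutral element has eigenvalue \<open>1\<close>; hence they are nonzero.
\<close>

lemma diagonal_action_weights:
  fixes G :: "('g, 'b) monoid_scheme"
  assumes G: "group G" "finite (carrier G)" and char: "\<not> CHAR('k::field) dvd card (carrier G)"
    and rep: "linear_rep G scale \<rho>" and basis: "dual_basis scale N (x :: nat \<Rightarrow> 'v::ab_group_add \<Rightarrow> 'k)"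
    and c: "\<And>g i. g \<in> carrier G \<Longrightarrow> i < N \<Longrightarrow> dual_act G \<rho> g (x i) = (\<lambda>v. c g i * x i v)"
  shows "diagonal_action G \<rho> N x c"
proof -
  interpret group G by fact
  have xi: "x i \<in> dual_space scale" if "i < N" for i using basis that by (auto simp: dual_basis_def)
  have mult: "c (g \<otimes>\<^bsub>G\<^esub> h) i = c g i * c h i" if g: "g \<in> carrier G" and h: "h \<in> carrier G" and i: "i < N" for g h i
  proof -
    obtain v where v: "x i v \<noteq> 0" using dual_basis_nonzero[OF basis i] by blast
    have "c (g \<otimes>\<^bsub>G\<^esub> h) i * x i v = x i (\<rho> (inv\<^bsub>G\<^esub> (g \<otimes>\<^bsub>G\<^esub> h)) v)"
      using fun_cong[OF c[of "g \<otimes>\<^bsub>G\<^esub> h" i], of v] g h i by (simp add: dual_act_def)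
    also have "\<dots> = x i (\<rho> (inv\<^bsub>G\<^esub> h) (\<rho> (inv\<^bsub>G\<^esub> g) v))"
      using g h rep by (simp add: inv_mult_group linear_rep_def)
    also have "\<dots> = c h i * x i (\<rho> (inv\<^bsub>G\<^esub> g) v)"
      using fun_cong[OF c[OF h i], of "\<rho> (inv\<^bsub>G\<^esub> g) v"] by (simp add: dual_act_def)
    also have "x i (\<rho> (inv\<^bsub>G\<^esub> g) v) = c g i * x i v"
      using fun_cong[OF c[OF g i], of v] by (simp add: dual_act_def)
    finally show ?thesis using v by (simp add: mult_ac)
  qed
  have one: "c \<one>\<^bsub>G\<^esub> i = 1" if i: "i < N" for i
  proof -
    obtain v where v: "x i v \<noteq> 0" using dual_basis_nonzero[OF basis i] by blast
    have "x i v = c \<one>\<^bsub>G\<^esub> i * x i v"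
      using fun_cong[OF c[OF one_closed i], of v] rep by (simp add: dual_act_def linear_rep_def)
    then show ?thesis using v by simp
  qed
  show ?thesis
  proof
    show "linear_form N x (dual_act G \<rho> g (x i)) = mconst (c g i) * mvar i"
      if g: "g \<in> carrier G" and i: "i < N" for g i
    proof -
      have "linear_form N x (dual_act G \<rho> g (x i)) = (\<Sum>j<N. mconst (if j = i then c g i else 0) * mvar j)"
        unfolding linear_form_def c[OF g i]
        by (simp add: coords_scalar_multiple[OF basis i dual_space_scalar_multiple[OF xi[OF i]]])
      also have "\<dots> = (\<Sum>j<N. if j = i then mconst (c g i) * mvar j else 0)"
        by (intro sum.cong) (auto simp: mconst_def)
      also have "\<dots> = mconst (c g i) * mvar i" using i by simp
      finally show ?thesis .
    qed
    show "c g i \<noteq> 0" if "g \<in> carrier G" "i < N" for g i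
      using mult[of g "inv\<^bsub>G\<^esub> g" i] one[of i] that by auto
  qed (use G char mult in auto)
qed

theorem lemma3p8:
  fixes G :: "('g, 'b) monoid_scheme"
    and scale :: "'k::field \<Rightarrow> 'v::ab_group_add \<Rightarrow> 'v"
    and V_basis :: "'v set"
    and \<rho> :: "'g \<Rightarrow> 'v \<Rightarrow> 'v"
    and N :: nat
    and x :: "nat \<Rightarrow> 'v \<Rightarrow> 'k"
  assumes "comm_group G" and "finite (carrier G)"
    and "\<not> CHAR('k) dvd card (carrier G)"
    and "card {z::'k. z ^ card (carrier G) = 1} = card (carrier G)"
    and "finite_dimensional_vector_space scale V_basis"
    and "linear_rep G scale \<rho>"
    and "vector_space.dim scale (UNIV :: 'v set) = N"
    and "dual_basis scale N x"
    and "\<And>g i. g \<in> carrier G \<Longrightarrow> i < N \<Longrightarrow> \<exists>c. dual_act G \<rho> g (x i) = (\<lambda>v. c * x i v)"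
  shows "beta_field G \<rho> N x =
           (LEAST d. 0 < d \<and>
              inv_lattice G \<rho> N x = group_closure (inv_lattice G \<rho> N x \<inter> lattice_points N d)) \<and>
         gamma_field G \<rho> N x =
           (LEAST d. 0 < d \<and>
              lattice_rank (group_closure (inv_lattice G \<rho> N x \<inter> lattice_points N d)) = N)"
proof -
  have "\<forall>g i. \<exists>a. g \<in> carrier G \<longrightarrow> i < N \<longrightarrow> dual_act G \<rho> g (x i) = (\<lambda>v. a * x i v)"
    using assms(9) by blast
  then obtain c where c: "\<And>g i. g \<in> carrier G \<Longrightarrow> i < N \<Longrightarrow> dual_act G \<rho> g (x i) = (\<lambda>v. c g i * x i v)"
    by metis
  have "group G" using assms(1) by (rule comm_group.axioms)
  then interpret diagonal_action G \<rho> N x c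
    using assms(2,3,6,8) c by (rule diagonal_action_weights)
  show ?thesis
    unfolding beta_field_def gamma_field_def
    using generates_inv_field_iff contains_transcendence_basis_iff by (simp cong: conj_cong)
qed

end
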